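(* Let $X$ be a connected topological space admitting a universal covering space $\widetilde X$, with $H^1(X;\mathbb{Z})=0$. Let $c\in H^2(X;\mathbb{Z})$ be a non-zero class that is equal to zero in $H^2(X;\mathbb{R})$, let $G=\mathrm{Homeo}(X,c)$ be the group of $c$-preserving homeomorphisms of $X$, and let $\rho\in H^1(X;S^1)$ be a class whose image under the connecting homomorphism $\mathbf{d}\colon H^1(X;S^1)\to H^2(X;\mathbb{Z})$ is $c$. Let $P_\rho^\delta=\widetilde X\times_\rho(S^1)^\delta$ and let $\mathrm{Aut}(P_\rho^\delta)$ denote its group of bundle automorphisms. Then the canonical projection $\pi\colon\mathrm{Aut}(P_\rho^\delta)\to\mathrm{Homeo}(X)$ induces a surjection $\mathrm{Aut}(P_\rho^\delta)\to G$ and its kernel is isomorphic to $S^1$. In particular, there is an exact sequence $$1\to S^1\to\mathrm{Aut}(P_\rho^\delta)\to G\to1.$$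
   Context: $S^1=\mathbb{R}/\mathbb{Z}$, and $(S^1)^\delta$ is $S^1$ with the discrete topology. The class $\rho$ is regarded as a homomorphism $\rho\colon\pi_1(X)\to S^1$ via $H^1(X;S^1)\cong\mathrm{Hom}(\pi_1(X),S^1)$, and $P_\rho^\delta\to X$ is the principal $(S^1)^\delta$-bundle (foliated $S^1$-bundle) with holonomy homomorphism $\rho$. The group $\mathrm{Homeo}(X,\rho)$ of $\rho$-preserving homeomorphisms of $X$ is equal to $G$.
   Formalization: The equality Homeo(X,ρ) = G, asserted in the surrounding text, is taken as a hypothesis since it does not follow from H^1(X;Z)=0 and the claim fails without it; the universal covering space is understood to be simply connected and locally path-connected. *)

theory Defs
  imports "HOL-Algebra.Bij" "HOL-Homology.Homology"
begin

section \<open>The circle group $\mathbb{R}/\mathbb{Z}$\<close>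

definition int_cong :: "real \<Rightarrow> real \<Rightarrow> bool"
  where "int_cong x y \<longleftrightarrow> x - y \<in> \<int>"

lemma equivp_int_cong: "equivp int_cong"
proof (rule equivpI)
  show "reflp int_cong"
    by (simp add: reflp_def int_cong_def)
  show "symp int_cong"
    unfolding symp_def int_cong_def by (metis Ints_minus minus_diff_eq)
  show "transp int_cong"
    unfolding transp_def int_cong_def by (metis Ints_add diff_add_cancel add_diff_eq)
qed

quotient_type circle = real / int_cong
  morphisms rep_circle to_circle
  by (rule equivp_int_cong)

instantiation circle :: ab_group_add
begin

lift_definition zero_circle :: circle is 0 .

lift_definition plus_circle :: "circle \<Rightarrow> circle \<Rightarrow> circle" is "(+)"
  by (simp add: int_cong_def add_diff_add)

lift_definition uminus_circle :: "circle \<Rightarrow> circle" is uminus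
  by (metis int_cong_def Ints_minus minus_diff_eq minus_diff_minus)

lift_definition minus_circle :: "circle \<Rightarrow> circle \<Rightarrow> circle" is "(-)"
proof -
  fix a b c d :: real
  assume "int_cong a b" "int_cong c d"
  then have "(a - b) - (c - d) \<in> \<int>"
    unfolding int_cong_def by (rule Ints_diff)
  then show "int_cong (a - c) (b - d)"
    by (simp add: int_cong_def algebra_simps)
qed

instance
  by standard (transfer, simp add: int_cong_def algebra_simps)+

end

definition circle_group :: "circle monoid"
  where "circle_group = \<lparr>carrier = UNIV, monoid.mult = (+), one = 0\<rparr>"


section \<open>Singular cohomology\<close>

text \<open>The coefficient group is a type of class \<^class>\<open>ab_group_add\<close>. A cochain is a homomorphism
  on the singular chains of \<open>X\<close>; it is set to be zero on all other elements of the type, so that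
  equal cochains are equal functions.\<close>

definition cochains :: "nat \<Rightarrow> 'a topology \<Rightarrow> ('a chain \<Rightarrow> 'k::ab_group_add) set"
  where "cochains p X =
    {\<phi>. (\<forall>a b. singular_chain p X a \<and> singular_chain p X b \<longrightarrow> \<phi> (a + b) = \<phi> a + \<phi> b) \<and>
        (\<forall>a. \<not> singular_chain p X a \<longrightarrow> \<phi> a = 0)}"

definition coboundary ::
    "nat \<Rightarrow> 'a topology \<Rightarrow> ('a chain \<Rightarrow> 'k::ab_group_add) \<Rightarrow> 'a chain \<Rightarrow> 'k"
  where "coboundary p X \<phi> =
    (\<lambda>a. if singular_chain (Suc p) X a then \<phi> (chain_boundary (Suc p) a) else 0)"

definition cocycles :: "nat \<Rightarrow> 'a topology \<Rightarrow> ('a chain \<Rightarrow> 'k::ab_group_add) set"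
  where "cocycles p X = {\<phi> \<in> cochains p X. coboundary p X \<phi> = (\<lambda>_. 0)}"

definition coboundaries :: "nat \<Rightarrow> 'a topology \<Rightarrow> ('a chain \<Rightarrow> 'k::ab_group_add) set"
  where "coboundaries p X =
    (case p of 0 \<Rightarrow> {\<lambda>_. 0} | Suc q \<Rightarrow> coboundary q X ` cochains q X)"

definition cocycle_group :: "nat \<Rightarrow> 'a topology \<Rightarrow> ('a chain \<Rightarrow> 'k::ab_group_add) monoid"
  where "cocycle_group p X =
    \<lparr>carrier = cocycles p X, monoid.mult = (\<lambda>\<phi> \<psi> a. \<phi> a + \<psi> a), one = (\<lambda>_. 0)\<rparr>"

definition cohomology_group ::
    "nat \<Rightarrow> 'a topology \<Rightarrow> ('a chain \<Rightarrow> 'k::ab_group_add) set monoid"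
  where "cohomology_group p X = cocycle_group p X Mod coboundaries p X"

definition cohomology_class ::
    "nat \<Rightarrow> 'a topology \<Rightarrow> ('a chain \<Rightarrow> 'k::ab_group_add) \<Rightarrow> ('a chain \<Rightarrow> 'k) set"
  where "cohomology_class p X \<phi> = coboundaries p X #>\<^bsub>cocycle_group p X\<^esub> \<phi>"

text \<open>A map on cohomology is given by what it does to representatives. All representatives of a
  class produce the same class, which is extracted with \<^const>\<open>the_elem\<close>.\<close>

definition coefficient_map ::
    "nat \<Rightarrow> 'a topology \<Rightarrow> ('k::ab_group_add \<Rightarrow> 'l::ab_group_add)
      \<Rightarrow> ('a chain \<Rightarrow> 'k) set \<Rightarrow> ('a chain \<Rightarrow> 'l) set"
  where "coefficient_map p X h \<alpha> = the_elem ((\<lambda>\<phi>. cohomology_class p X (h \<circ> \<phi>)) ` \<alpha>)"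

definition cochain_pullback ::
    "nat \<Rightarrow> 'a topology \<Rightarrow> ('a \<Rightarrow> 'b) \<Rightarrow> ('b chain \<Rightarrow> 'k::ab_group_add) \<Rightarrow> 'a chain \<Rightarrow> 'k"
  where "cochain_pullback p X f \<phi> =
    (\<lambda>a. if singular_chain p X a then \<phi> (chain_map p f a) else 0)"

definition cohomology_pullback ::
    "nat \<Rightarrow> 'a topology \<Rightarrow> ('a \<Rightarrow> 'b) \<Rightarrow> ('b chain \<Rightarrow> 'k::ab_group_add) set \<Rightarrow> ('a chain \<Rightarrow> 'k) set"
  where "cohomology_pullback p X f \<alpha> =
    the_elem ((\<lambda>\<phi>. cohomology_class p X (cochain_pullback p X f \<phi>)) ` \<alpha>)"

text \<open>The connecting homomorphism of $0 \to \mathbb{Z} \to \mathbb{R} \to \mathbb{R}/\mathbb{Z} \to 0$: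
  lift a representing cocycle to a real cochain \<open>\<psi>\<close>; its coboundary is an integral cocycle \<open>\<kappa>\<close>.\<close>

definition connecting_hom ::
    "nat \<Rightarrow> 'a topology \<Rightarrow> ('a chain \<Rightarrow> circle) set \<Rightarrow> ('a chain \<Rightarrow> int) set"
  where "connecting_hom p X \<alpha> =
    the_elem {cohomology_class (Suc p) X \<kappa> | \<kappa> \<psi>.
      \<psi> \<in> cochains p X \<and> to_circle \<circ> \<psi> \<in> \<alpha> \<and>
      \<kappa> \<in> cocycles (Suc p) X \<and> real_of_int \<circ> \<kappa> = coboundary p X \<psi>}"


section \<open>Homeomorphism groups\<close>

definition homeo_group :: "'a topology \<Rightarrow> ('a \<Rightarrow> 'a) monoid"
  where "homeo_group X =
    BijGroup (topspace X) \<lparr>carrier := {f \<in> Bij (topspace X). homeomorphic_map X X f}\<rparr>"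

definition homeo_group_preserving ::
    "nat \<Rightarrow> 'a topology \<Rightarrow> ('a chain \<Rightarrow> 'k::ab_group_add) set \<Rightarrow> ('a \<Rightarrow> 'a) monoid"
  where "homeo_group_preserving p X \<alpha> =
    homeo_group X
      \<lparr>carrier := {f \<in> carrier (homeo_group X). cohomology_pullback p X f \<alpha> = \<alpha>}\<rparr>"


section \<open>The fundamental group\<close>

definition loops :: "'a topology \<Rightarrow> 'a \<Rightarrow> (real \<Rightarrow> 'a) set"
  where "loops X x = {\<gamma>. pathin X \<gamma> \<and> \<gamma> 0 = x \<and> \<gamma> 1 = x}"

definition loop_class :: "'a topology \<Rightarrow> 'a \<Rightarrow> (real \<Rightarrow> 'a) \<Rightarrow> (real \<Rightarrow> 'a) set"
  where "loop_class X x \<gamma> =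
    {\<gamma>'. homotopic_with (\<lambda>h. h 0 = x \<and> h 1 = x) (top_of_set {0..1}) X \<gamma> \<gamma>'}"

definition path_concat :: "(real \<Rightarrow> 'a) \<Rightarrow> (real \<Rightarrow> 'a) \<Rightarrow> real \<Rightarrow> 'a"
  where "path_concat \<gamma> \<delta> = (\<lambda>t. if t \<le> 1/2 then \<gamma> (2 * t) else \<delta> (2 * t - 1))"

definition fundamental_group :: "'a topology \<Rightarrow> 'a \<Rightarrow> (real \<Rightarrow> 'a) set monoid"
  where "fundamental_group X x =
    \<lparr>carrier = loop_class X x ` loops X x,
     monoid.mult = (\<lambda>A B. the_elem {loop_class X x (path_concat \<gamma> \<delta>) | \<gamma> \<delta>. \<gamma> \<in> A \<and> \<delta> \<in> B}),
     one = loop_class X x (\<lambda>_. x)\<rparr>"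

text \<open>The isomorphism $H^1(X;S^1) \cong \mathrm{Hom}(\pi_1(X),S^1)$ evaluates a cocycle on loops.
  The coordinate \<open>v 1\<close> identifies the standard 1-simplex with \<open>{0..1}\<close>.\<close>

definition path_simplex :: "(real \<Rightarrow> 'a) \<Rightarrow> (nat \<Rightarrow> real) \<Rightarrow> 'a"
  where "path_simplex \<gamma> = restrict (\<lambda>v. \<gamma> (v 1)) (standard_simplex 1)"

definition holonomy :: "('a chain \<Rightarrow> circle) set \<Rightarrow> (real \<Rightarrow> 'a) set \<Rightarrow> circle"
  where "holonomy \<rho> C = the_elem {\<phi> (frag_of (path_simplex \<gamma>)) | \<phi> \<gamma>. \<phi> \<in> \<rho> \<and> \<gamma> \<in> C}"


section \<open>Universal coverings\<close>

definition covering_map :: "'e topology \<Rightarrow> 'a topology \<Rightarrow> ('e \<Rightarrow> 'a) \<Rightarrow> bool"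
  where "covering_map E X p \<longleftrightarrow>
    continuous_map E X p \<and> p ` topspace E = topspace X \<and>
    (\<forall>x \<in> topspace X. \<exists>T. x \<in> T \<and> openin X T \<and>
      (\<exists>v. \<Union>v = {e \<in> topspace E. p e \<in> T} \<and> (\<forall>u \<in> v. openin E u) \<and> pairwise disjnt v \<and>
           (\<forall>u \<in> v. homeomorphic_map (subtopology E u) (subtopology X T) p)))"

definition simply_connected_space :: "'a topology \<Rightarrow> bool"
  where "simply_connected_space X \<longleftrightarrow>
    path_connected_space X \<and>
    (\<forall>x \<in> topspace X. trivial_group (fundamental_group X x))"

text \<open>As usual in covering space theory, spaces are locally path-connected here. Otherwise the
  fundamental group of the base need not act on a simply connected covering by homeomorphisms.\<close>

definition universal_covering :: "'e topology \<Rightarrow> 'a topology \<Rightarrow> ('e \<Rightarrow> 'a) \<Rightarrow> bool"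
  where "universal_covering E X p \<longleftrightarrow>
    covering_map E X p \<and> locally_path_connected_space E \<and> simply_connected_space E"

definition deck_transformations :: "'e topology \<Rightarrow> ('e \<Rightarrow> 'a) \<Rightarrow> ('e \<Rightarrow> 'e) set"
  where "deck_transformations E p =
    {g \<in> carrier (homeo_group E). \<forall>e \<in> topspace E. p (g e) = p e}"

definition lift_endpoint :: "'e topology \<Rightarrow> ('e \<Rightarrow> 'a) \<Rightarrow> 'e \<Rightarrow> (real \<Rightarrow> 'a) \<Rightarrow> 'e"
  where "lift_endpoint E p e\<^sub>0 \<gamma> =
    (THE e. \<exists>\<delta>. pathin E \<delta> \<and> \<delta> 0 = e\<^sub>0 \<and> \<delta> 1 = e \<and> (\<forall>t \<in> {0..1}. p (\<delta> t) = \<gamma> t))"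

text \<open>The action of $\pi_1(X, p(e_0))$ on the universal covering: \<open>C\<close> acts by the deck transformation
  that takes \<open>e\<^sub>0\<close> to the endpoint of the lifts of the loops in \<open>C\<close> starting at \<open>e\<^sub>0\<close>.\<close>

definition deck_action :: "'e topology \<Rightarrow> ('e \<Rightarrow> 'a) \<Rightarrow> 'e \<Rightarrow> (real \<Rightarrow> 'a) set \<Rightarrow> 'e \<Rightarrow> 'e"
  where "deck_action E p e\<^sub>0 C =
    (THE g. g \<in> deck_transformations E p \<and> (\<forall>\<gamma> \<in> C. g e\<^sub>0 = lift_endpoint E p e\<^sub>0 \<gamma>))"


section \<open>The foliated circle bundle with holonomy \<open>\<rho>\<close>\<close>

text \<open>The total space is the orbit space of the diagonal action of the fundamental group on the
  product of \<open>E\<close> and the discrete circle.\<close>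

definition bundle_rel ::
    "'e topology \<Rightarrow> 'a topology \<Rightarrow> ('e \<Rightarrow> 'a) \<Rightarrow> 'e \<Rightarrow> ('a chain \<Rightarrow> circle) set
      \<Rightarrow> (('e \<times> circle) \<times> ('e \<times> circle)) set"
  where "bundle_rel E X p e\<^sub>0 \<rho> =
    {((e, z), (deck_action E p e\<^sub>0 C e, holonomy \<rho> C + z)) | e z C.
       e \<in> topspace E \<and> C \<in> carrier (fundamental_group X (p e\<^sub>0))}"

definition bundle_space ::
    "'e topology \<Rightarrow> 'a topology \<Rightarrow> ('e \<Rightarrow> 'a) \<Rightarrow> 'e \<Rightarrow> ('a chain \<Rightarrow> circle) set
      \<Rightarrow> ('e \<times> circle) set topology"
  where "bundle_space E X p e\<^sub>0 \<rho> =
    topology (\<lambda>U. U \<subseteq> (topspace E \<times> UNIV) // bundle_rel E X p e\<^sub>0 \<rho> \<and>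
                  openin (prod_topology E (discrete_topology UNIV)) (\<Union>U))"

definition bundle_proj :: "('e \<Rightarrow> 'a) \<Rightarrow> ('e \<times> circle) set \<Rightarrow> 'a"
  where "bundle_proj p u = the_elem ((p \<circ> fst) ` u)"

definition circle_action :: "('e \<times> circle) set \<Rightarrow> circle \<Rightarrow> ('e \<times> circle) set"
  where "circle_action u s = (\<lambda>(e, z). (e, z + s)) ` u"

definition bundle_aut_group ::
    "'e topology \<Rightarrow> 'a topology \<Rightarrow> ('e \<Rightarrow> 'a) \<Rightarrow> 'e \<Rightarrow> ('a chain \<Rightarrow> circle) set
      \<Rightarrow> (('e \<times> circle) set \<Rightarrow> ('e \<times> circle) set) monoid"
  where "bundle_aut_group E X p e\<^sub>0 \<rho> =
    (let P = bundle_space E X p e\<^sub>0 \<rho> in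
      homeo_group P \<lparr>carrier :=
        {F \<in> carrier (homeo_group P).
          (\<forall>u \<in> topspace P. \<forall>s. F (circle_action u s) = circle_action (F u) s) \<and>
          (\<exists>f \<in> carrier (homeo_group X). \<forall>u \<in> topspace P. bundle_proj p (F u) = f (bundle_proj p u))}\<rparr>)"

definition base_map ::
    "'e topology \<Rightarrow> 'a topology \<Rightarrow> ('e \<Rightarrow> 'a) \<Rightarrow> 'e \<Rightarrow> ('a chain \<Rightarrow> circle) set
      \<Rightarrow> (('e \<times> circle) set \<Rightarrow> ('e \<times> circle) set) \<Rightarrow> 'a \<Rightarrow> 'a"
  where "base_map E X p e\<^sub>0 \<rho> F =
    (THE f. f \<in> carrier (homeo_group X) \<and>
            (\<forall>u \<in> topspace (bundle_space E X p e\<^sub>0 \<rho>). bundle_proj p (F u) = f (bundle_proj p u)))"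


section \<open>Short exact sequences\<close>

text \<open>The library's \<^const>\<open>short_exact_sequence\<close> requires the three groups to have the same
  element type.\<close>

definition short_exact :: "'a monoid \<Rightarrow> 'b monoid \<Rightarrow> 'c monoid \<Rightarrow> ('a \<Rightarrow> 'b) \<Rightarrow> ('b \<Rightarrow> 'c) \<Rightarrow> bool"
  where "short_exact A B C i q \<longleftrightarrow>
    group_hom A B i \<and> group_hom B C q \<and>
    inj_on i (carrier A) \<and> i ` carrier A = kernel B C q \<and> q ` carrier B = carrier C"

end

theory Submission
  imports Defs
begin

text \<open>
  The bundle is understood by untwisting it on the universal covering \<open>p: E \<rightarrow> X\<close>. Fix a cocycle
  \<open>\<phi>\<close> representing \<open>\<rho>\<close>. Its pullback to the simply connected space \<open>E\<close> vanishes on loops, so it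
  has a primitive \<open>h: E \<rightarrow> \<real>/\<int>\<close>: the value of \<open>\<phi>\<close> on the image of a path in \<open>E\<close> is the difference
  of \<open>h\<close> at its ends (\<open>path_value_lift_primitive\<close>). If \<open>g\<close> is the deck transformation of a loop
  class \<open>C\<close>, then \<open>h (g e) - h e\<close> is the holonomy of \<open>C\<close>, whatever \<open>e\<close> is. As the deck group is
  transitive on fibres, two pairs \<open>(e, z)\<close> and \<open>(e', z')\<close> define the same point of the bundle exactly
  if \<open>p e = p e'\<close> and \<open>z - h e = z' - h e'\<close> (\<open>bundle_rel_iff\<close>). From here on the fundamental group is
  no longer needed.

  A homeomorphism \<open>f\<close> of \<open>X\<close> lifts to a homeomorphism \<open>F\<close> of \<open>E\<close>. The map \<open>(e, z) \<mapsto> (F e, z + s)\<close>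
  descends to the bundle exactly if \<open>h (F e) - h e\<close> depends only on \<open>p e\<close>, and evaluation on loops
  shows that this means \<open>f\<^sup>* \<rho> = \<rho>\<close> (\<open>fibre_compatible_iff\<close>), because a one-cocycle is a coboundary
  as soon as it vanishes on loops (\<open>cocycle_coboundary_iff\<close>). Conversely every bundle automorphism \<open>A\<close>
  over \<open>f\<close> has this form (\<open>Aut_eq_bundle_map\<close>): it takes the class of \<open>(e, 0)\<close> to the class of
  \<open>(F e, b e)\<close> for some \<open>b\<close>; since the circle is discrete, \<open>b\<close> is locally constant, hence constant on
  the connected space \<open>E\<close>. Therefore the image of the projection to \<open>Homeo(X)\<close> is the stabiliser of
  \<open>\<rho>\<close>, which is the group \<open>G\<close>. Over the identity one can choose \<open>F\<close> to be the identity, so the kernel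
  consists of the translations by elements of the circle, and these act freely.

  The existence of \<open>F\<close>, and of the deck transformations in particular, is the lifting criterion for
  maps from simply connected, locally path-connected spaces, which rests on the lifting of homotopies
  (\<open>covering_map_tube_lift\<close>, \<open>covering_map_monodromy\<close>).
\<close>

section \<open>Covering maps\<close>

lemma continuous_map_mem: "continuous_map X Y f \<Longrightarrow> x \<in> topspace X \<Longrightarrow> f x \<in> topspace Y"
  by (auto dest: continuous_map_funspace)

lemma connected_space_locally_constant:
  assumes "connected_space Z"
    and loc: "\<And>z. z \<in> topspace Z \<Longrightarrow> \<exists>U. openin Z U \<and> z \<in> U \<and> (\<forall>w\<in>U. P w = P z)"
    and "a \<in> topspace Z" "b \<in> topspace Z"
  shows "P a = P b"
proof -
  have open_level: "openin Z {z \<in> topspace Z. Q (P z)}" for Q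
  proof (subst openin_subopen, intro ballI)
    fix z assume z: "z \<in> {z \<in> topspace Z. Q (P z)}"
    then obtain U where U: "openin Z U" "z \<in> U" "\<forall>w\<in>U. P w = P z"
      using loc by blast
    have "U \<subseteq> {z \<in> topspace Z. Q (P z)}"
    proof
      fix w assume w: "w \<in> U"
      then have "P w = P z"
        using U(3) by blast
      then show "w \<in> {z \<in> topspace Z. Q (P z)}"
        using w z openin_subset[OF U(1)] by auto
    qed
    then show "\<exists>T. openin Z T \<and> z \<in> T \<and> T \<subseteq> {z \<in> topspace Z. Q (P z)}"
      using U by blast
  qed
  let ?S = "{z \<in> topspace Z. P z = P a}"
  have "topspace Z - ?S = {z \<in> topspace Z. P z \<noteq> P a}"
    by auto
  then have "closedin Z ?S"
    using open_level[of "\<lambda>v. v \<noteq> P a"] by (simp add: closedin_def)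
  moreover have "openin Z ?S"
    using open_level[of "\<lambda>v. v = P a"] .
  ultimately have "?S = {} \<or> ?S = topspace Z"
    using assms(1) connected_space_clopen_in by blast
  moreover have "a \<in> ?S"
    using assms(3) by simp
  ultimately have "b \<in> ?S"
    using assms(4) by blast
  then show ?thesis
    by simp
qed

text \<open>A sheet \<open>u\<close> over \<open>T\<close> is recorded together with the inverse \<open>s\<close> of \<open>p\<close> on it.\<close>

definition sheet :: "'e topology \<Rightarrow> 'a topology \<Rightarrow> ('e \<Rightarrow> 'a) \<Rightarrow> 'a set \<Rightarrow> 'e set \<Rightarrow> ('a \<Rightarrow> 'e) \<Rightarrow> bool"
  where "sheet E X p T u s \<longleftrightarrow>
    openin E u \<and> continuous_map (subtopology X T) E s \<and>
    (\<forall>d \<in> u. p d \<in> T \<and> s (p d) = d) \<and> (\<forall>x \<in> T. s x \<in> u \<and> p (s x) = x)"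

lemma covering_map_evenly_covered:
  assumes "covering_map E X p" "x \<in> topspace X"
  obtains T v where "x \<in> T" "openin X T" "\<Union>v = {e \<in> topspace E. p e \<in> T}"
    "\<And>u. u \<in> v \<Longrightarrow> openin E u" "pairwise disjnt v"
    "\<And>u. u \<in> v \<Longrightarrow> homeomorphic_map (subtopology E u) (subtopology X T) p"
proof -
  from assms obtain T where "x \<in> T" "openin X T"
    "\<exists>v. \<Union>v = {e \<in> topspace E. p e \<in> T} \<and> (\<forall>u \<in> v. openin E u) \<and> pairwise disjnt v \<and>
      (\<forall>u \<in> v. homeomorphic_map (subtopology E u) (subtopology X T) p)"
    unfolding covering_map_def by blast
  then show ?thesis
    by (elim exE conjE) (rule that, auto)
qed

lemma covering_map_sheets:
  assumes "covering_map E X p" "x \<in> topspace X"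
  obtains T where "openin X T" "x \<in> T"
    "\<And>e. \<lbrakk>e \<in> topspace E; p e \<in> T\<rbrakk> \<Longrightarrow> \<exists>u s. e \<in> u \<and> sheet E X p T u s"
proof -
  obtain T v where T: "x \<in> T" "openin X T"
    and v: "\<Union>v = {e \<in> topspace E. p e \<in> T}" "\<And>u. u \<in> v \<Longrightarrow> openin E u" "pairwise disjnt v"
      "\<And>u. u \<in> v \<Longrightarrow> homeomorphic_map (subtopology E u) (subtopology X T) p"
    using covering_map_evenly_covered[OF assms] by blast
  have "\<exists>u s. e \<in> u \<and> sheet E X p T u s" if "e \<in> topspace E" "p e \<in> T" for e
  proof -
    from that v(1) obtain u where u: "u \<in> v" "e \<in> u"
      by blast
    from v(4)[OF u(1)] obtain s where s: "homeomorphic_maps (subtopology E u) (subtopology X T) p s"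
      using homeomorphic_map_maps by blast
    have tops: "topspace (subtopology E u) = u" "topspace (subtopology X T) = T"
      using openin_subset[OF v(2)[OF u(1)]] openin_subset[OF T(2)] by auto
    have "continuous_map (subtopology X T) E s" "continuous_map (subtopology X T) (subtopology E u) s"
      "continuous_map (subtopology E u) (subtopology X T) p"
      "\<forall>d\<in>u. s (p d) = d" "\<forall>x\<in>T. p (s x) = x"
      using s unfolding homeomorphic_maps_def tops by (auto simp: continuous_map_in_subtopology)
    then have "sheet E X p T u s"
      unfolding sheet_def using v(2)[OF u(1)]
      using continuous_map_mem[of "subtopology X T" "subtopology E u" s]
        continuous_map_mem[of "subtopology E u" "subtopology X T" p] unfolding tops by simp
    then show ?thesis
      using u(2) by blast
  qed
  then show ?thesis
    using that T by blast
qed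

lemma covering_map_sheet_at:
  assumes "covering_map E X p" "e \<in> topspace E"
  obtains T u s where "openin X T" "p e \<in> T" "e \<in> u" "sheet E X p T u s"
proof -
  have "p e \<in> topspace X"
    using assms unfolding covering_map_def by blast
  with assms show ?thesis
    by (metis covering_map_sheets that)
qed

lemma sheet_inj: "sheet E X p T u s \<Longrightarrow> d \<in> u \<Longrightarrow> d' \<in> u \<Longrightarrow> p d = p d' \<Longrightarrow> d = d'"
  unfolding sheet_def by metis

text \<open>Distinct points of a fibre lie on different sheets over a common neighbourhood, and these are
  disjoint. The total space itself may fail to be Hausdorff.\<close>

lemma covering_map_fibre_separated:
  assumes "covering_map E X p" "e \<in> topspace E" "e' \<in> topspace E" "p e = p e'" "e \<noteq> e'"
  obtains U V where "openin E U" "openin E V" "e \<in> U" "e' \<in> V" "U \<inter> V = {}"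
proof -
  have "p e \<in> topspace X"
    using assms unfolding covering_map_def by blast
  then obtain T v where T: "p e \<in> T" "openin X T"
    and v: "\<Union>v = {e \<in> topspace E. p e \<in> T}" "\<And>u. u \<in> v \<Longrightarrow> openin E u" "pairwise disjnt v"
      "\<And>u. u \<in> v \<Longrightarrow> homeomorphic_map (subtopology E u) (subtopology X T) p"
    using covering_map_evenly_covered[OF assms(1)] by blast
  obtain u u' where u: "u \<in> v" "e \<in> u" "u' \<in> v" "e' \<in> u'"
    using assms v(1) T by (metis (mono_tags, lifting) UnionE mem_Collect_eq)
  have "inj_on p u"
    using homeomorphic_imp_injective_map[OF v(4)[OF u(1)]] openin_subset[OF v(2)[OF u(1)]]
    by (simp add: Int_absorb1)
  then have "u \<noteq> u'"
    using u assms by (auto dest: inj_onD)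
  then have "u \<inter> u' = {}"
    using v(3) u by (auto simp: pairwise_def disjnt_def)
  then show ?thesis
    using that u v(2) by blast
qed

text \<open>Two lifts agree on an open set because \<open>p\<close> is injective on sheets, and they differ on an open
  set because fibres are separated.\<close>

lemma covering_map_unique_lift:
  assumes cov: "covering_map E X p" and "connected_space Z"
    and k1: "continuous_map Z E k\<^sub>1" and k2: "continuous_map Z E k\<^sub>2"
    and eq: "\<And>z. z \<in> topspace Z \<Longrightarrow> p (k\<^sub>1 z) = p (k\<^sub>2 z)"
    and z0: "z\<^sub>0 \<in> topspace Z" "k\<^sub>1 z\<^sub>0 = k\<^sub>2 z\<^sub>0"
    and z: "z \<in> topspace Z"
  shows "k\<^sub>1 z = k\<^sub>2 z"
proof -
  have "(k\<^sub>1 z\<^sub>0 = k\<^sub>2 z\<^sub>0) = (k\<^sub>1 z = k\<^sub>2 z)"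
  proof (rule connected_space_locally_constant[OF \<open>connected_space Z\<close> _ z0(1) z])
    fix w assume w: "w \<in> topspace Z"
    then have kE: "k\<^sub>1 w \<in> topspace E" "k\<^sub>2 w \<in> topspace E"
      using k1 k2 by (auto dest: continuous_map_funspace)
    show "\<exists>U. openin Z U \<and> w \<in> U \<and> (\<forall>y\<in>U. (k\<^sub>1 y = k\<^sub>2 y) = (k\<^sub>1 w = k\<^sub>2 w))"
    proof (cases "k\<^sub>1 w = k\<^sub>2 w")
      case True
      obtain T u s where u: "k\<^sub>1 w \<in> u" "sheet E X p T u s"
        by (metis covering_map_sheet_at[OF cov kE(1)])
      let ?U = "{y \<in> topspace Z. k\<^sub>1 y \<in> u} \<inter> {y \<in> topspace Z. k\<^sub>2 y \<in> u}"
      have "openin Z ?U"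
        using u k1 k2 by (auto simp: sheet_def intro!: openin_continuous_map_preimage)
      moreover have "w \<in> ?U"
        using w u True by simp
      moreover have "\<forall>y\<in>?U. (k\<^sub>1 y = k\<^sub>2 y) = (k\<^sub>1 w = k\<^sub>2 w)"
        using sheet_inj[OF u(2)] eq True by simp
      ultimately show ?thesis
        by blast
    next
      case False
      obtain U V where UV: "openin E U" "openin E V" "k\<^sub>1 w \<in> U" "k\<^sub>2 w \<in> V" "U \<inter> V = {}"
        using covering_map_fibre_separated[OF cov kE eq[OF w] False] .
      let ?U = "{y \<in> topspace Z. k\<^sub>1 y \<in> U} \<inter> {y \<in> topspace Z. k\<^sub>2 y \<in> V}"
      have "openin Z ?U"
        using UV k1 k2 by (intro openin_Int openin_continuous_map_preimage)
      then show ?thesis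
        using False UV w by (intro exI[of _ ?U]) auto
    qed
  qed
  then show ?thesis
    using z0 by blast
qed

abbreviation unit_interval :: "real topology"
  where "unit_interval \<equiv> top_of_set {0..1}"

lemma connected_unit_interval: "connected_space unit_interval"
  by (metis connected_Icc connected_space_subtopology connectedin_iff_connected)

text \<open>Lifting a family of paths near one parameter \<open>y\<close>. That a lift over \<open>[0, t]\<close> exists on some
  neighbourhood of \<open>y\<close> is a locally constant property of \<open>t\<close>: while the path of \<open>y\<close> stays in an
  evenly covered set, a lift is prolonged by the inverse of \<open>p\<close> on one sheet, at the price of
  shrinking the neighbourhood. So connectedness of the interval replaces the choice of a
  subdivision.\<close>

lemma covering_map_tube_lift:
  assumes cov: "covering_map E X p"
    and H: "continuous_map (prod_topology Y unit_interval) X H"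
    and f0: "continuous_map Y E f\<^sub>0" "\<And>y. y \<in> topspace Y \<Longrightarrow> p (f\<^sub>0 y) = H (y, 0)"
    and y: "y \<in> topspace Y"
  obtains N K where "openin Y N" "y \<in> N"
    "continuous_map (prod_topology (subtopology Y N) unit_interval) E K"
    "\<And>n. n \<in> N \<Longrightarrow> K (n, 0) = f\<^sub>0 n"
    "\<And>n t. n \<in> N \<Longrightarrow> t \<in> {0..1} \<Longrightarrow> p (K (n, t)) = H (n, t)"
proof -
  define lifts where "lifts N t K \<longleftrightarrow> openin Y N \<and> y \<in> N \<and>
    continuous_map (prod_topology (subtopology Y N) (top_of_set {0..t})) E K \<and>
    (\<forall>n\<in>N. K (n, 0) = f\<^sub>0 n) \<and> (\<forall>n\<in>N. \<forall>r\<in>{0..t}. p (K (n, r)) = H (n, r))" for N t K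
  let ?P = "\<lambda>t. \<exists>N K. lifts N t K"
  have mono: "?P t'" if "?P t" "t' \<le> t" for t t'
  proof -
    from that obtain N K where K: "lifts N t K" by blast
    have "continuous_map (prod_topology (subtopology Y N) (top_of_set {0..t'})) E K"
      using K that(2) unfolding lifts_def prod_topology_subtopology
      by (elim conjE continuous_map_from_subtopology_mono) auto
    then have "lifts N t' K"
      using K that(2) unfolding lifts_def by auto
    then show ?thesis by blast
  qed
  have "?P 0 = ?P 1"
  proof (rule connected_space_locally_constant[OF connected_unit_interval])
    fix t assume "t \<in> topspace unit_interval"
    then have t: "t \<in> {0..1}" by simp
    then have "H (y, t) \<in> topspace X"
      using continuous_map_funspace[OF H] y by auto
    then obtain T where T: "openin X T" "H (y, t) \<in> T"
      "\<And>e. \<lbrakk>e \<in> topspace E; p e \<in> T\<rbrakk> \<Longrightarrow> \<exists>u s. e \<in> u \<and> sheet E X p T u s"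
      using covering_map_sheets[OF cov] by blast
    have "openin (prod_topology Y unit_interval) {q \<in> topspace (prod_topology Y unit_interval). H q \<in> T}"
      using H T(1) by (rule openin_continuous_map_preimage)
    then obtain M J where MJ: "openin Y M" "openin unit_interval J" "y \<in> M" "t \<in> J"
      "M \<times> J \<subseteq> {q \<in> topspace (prod_topology Y unit_interval). H q \<in> T}"
      using t y T(2) unfolding openin_prod_topology_alt
      by (elim allE[of _ y] allE[of _ t] impE) auto
    obtain d where d: "d > 0" "\<And>r. r \<in> {0..1} \<Longrightarrow> dist r t < d \<Longrightarrow> r \<in> J"
      using MJ(2,4) unfolding openin_euclidean_subtopology_iff by blast
    let ?I = "{0..1} \<inter> ball t d"
    have HT: "H (m, r) \<in> T" if "m \<in> M" "r \<in> ?I" for m r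
      using MJ(5) d(2)[of r] that by (auto simp: dist_commute)
    have step: "?P r'" if r: "?P r" "r \<in> ?I" "r' \<in> ?I" "r \<le> r'" for r r'
    proof -
      from r obtain N K where K: "lifts N r K" by blast
      have r01: "0 \<le> r" "r' \<le> 1" using r by auto
      have Kc: "continuous_map (prod_topology (subtopology Y N) (top_of_set {0..r})) E K"
        and N: "openin Y N" "y \<in> N" using K by (auto simp: lifts_def)
      have Kr: "continuous_map (subtopology Y N) E (\<lambda>n. K (n, r))"
        using r01 by (intro continuous_map_compose[OF _ Kc, unfolded o_def])
          (auto simp: continuous_map_pairwise o_def)
      have topN: "topspace (subtopology Y N) = N"
        using openin_subset[OF N(1)] by auto
      have "K (y, r) \<in> topspace E" "p (K (y, r)) \<in> T"
        using continuous_map_funspace[OF Kr] N K HT[OF MJ(3), of r] r r01 topN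
        by (auto simp: lifts_def)
      then obtain u s where u: "K (y, r) \<in> u" and s: "sheet E X p T u s"
        using T(3) by blast
      define N' where "N' = {n \<in> topspace (subtopology Y N). K (n, r) \<in> u} \<inter> M"
      have "openin (subtopology Y N) {n \<in> topspace (subtopology Y N). K (n, r) \<in> u}"
        using s by (intro openin_continuous_map_preimage[OF Kr]) (simp add: sheet_def)
      then have N': "openin Y N'"
        unfolding N'_def using MJ(1) N(1) by (meson openin_Int openin_trans_full)
      have sub: "N' \<subseteq> N" "N' \<subseteq> M" "y \<in> N'" "\<And>n. n \<in> N' \<Longrightarrow> K (n, r) \<in> u"
        using topN u MJ(3) N by (auto simp: N'_def)
      define K' where "K' = (\<lambda>q. if snd q \<le> r then K q else s (H q))"
      let ?Z = "prod_topology (subtopology Y N') (top_of_set {0..r'})"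
      have topZ: "topspace ?Z = N' \<times> {0..r'}"
        using openin_subset[OF N'] by auto
      have "continuous_map ?Z E K'"
        unfolding K'_def
      proof (rule continuous_map_cases_le)
        show "continuous_map ?Z euclideanreal snd"
          by (rule continuous_map_into_fulltopology[OF continuous_map_snd])
        show "continuous_map ?Z euclideanreal (\<lambda>q. r)"
          by simp
        show "continuous_map (subtopology ?Z {x \<in> topspace ?Z. snd x \<le> r}) E K"
          using Kc sub topN
          unfolding prod_topology_subtopology subtopology_subtopology
          by (elim continuous_map_from_subtopology_mono) auto
        have "continuous_map (subtopology ?Z {x \<in> topspace ?Z. r \<le> snd x}) (subtopology X T) H"
          unfolding continuous_map_in_subtopology
        proof
          show "continuous_map (subtopology ?Z {x \<in> topspace ?Z. r \<le> snd x}) X H"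
            using H r01(2)
            unfolding prod_topology_subtopology subtopology_subtopology
            by (elim continuous_map_from_subtopology_mono) auto
          show "H \<in> topspace (subtopology ?Z {x \<in> topspace ?Z. r \<le> snd x}) \<rightarrow> T"
          proof
            fix q assume "q \<in> topspace (subtopology ?Z {x \<in> topspace ?Z. r \<le> snd x})"
            then have "fst q \<in> M" "snd q \<in> {r..r'}"
              using sub topZ by auto
            then show "H q \<in> T"
              using HT[of "fst q" "snd q"] r by (auto simp: dist_real_def)
          qed
        qed
        then show "continuous_map (subtopology ?Z {x \<in> topspace ?Z. r \<le> snd x}) E (\<lambda>q. s (H q))"
          using s unfolding sheet_def o_def[symmetric] by (blast intro: continuous_map_compose)
        show "K q = s (H q)" if q: "q \<in> topspace ?Z" "snd q = r" for q
        proof -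
          obtain n where n: "q = (n, r)" "n \<in> N'"
            using q topZ by (cases q) auto
          then have "p (K q) = H q" "K q \<in> u"
            using K sub r01 by (auto simp: lifts_def)
          then show ?thesis
            using s by (metis sheet_def)
        qed
      qed
      moreover have "p (K' (n, t)) = H (n, t)" if "n \<in> N'" "t \<in> {0..r'}" for n t
      proof (cases "t \<le> r")
        case True
        then show ?thesis using K that sub by (auto simp: lifts_def K'_def)
      next
        case False
        then have "H (n, t) \<in> T"
          using that sub r by (intro HT) (auto simp: dist_real_def)
        then show ?thesis using False s by (auto simp: sheet_def K'_def)
      qed
      moreover have "K' (n, 0) = f\<^sub>0 n" if "n \<in> N'" for n
        using K that sub r01 by (auto simp: lifts_def K'_def)
      ultimately have "lifts N' r' K'"
        using N' sub by (simp add: lifts_def)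
      then show ?thesis by blast
    qed
    have "\<forall>r\<in>?I. ?P r = ?P t"
    proof
      fix r assume r: "r \<in> ?I"
      have tI: "t \<in> ?I" using t d by simp
      show "?P r = ?P t"
      proof (cases "r \<le> t")
        case True
        show ?thesis by (rule iffI[OF step[OF _ r tI True] mono[OF _ True]])
      next
        case False
        then have "t \<le> r" by simp
        show ?thesis by (rule iffI[OF mono[OF _ \<open>t \<le> r\<close>] step[OF _ tI r \<open>t \<le> r\<close>]])
      qed
    qed
    moreover have "openin unit_interval ?I"
      by (simp add: openin_open_Int)
    moreover have "t \<in> ?I"
      using t d by simp
    ultimately show "\<exists>U. openin unit_interval U \<and> t \<in> U \<and> (\<forall>r\<in>U. ?P r = ?P t)"
      by blast
  qed auto
  moreover have "lifts (topspace Y) 0 (\<lambda>q. f\<^sub>0 (fst q))"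
    unfolding lifts_def using y f0 by (simp add: continuous_map_of_fst[unfolded o_def])
  ultimately obtain N K where "lifts N 1 K" by blast
  then show ?thesis
    using that unfolding lifts_def by blast
qed


text \<open>The one-point parameter space gives the lifting of a single path.\<close>

corollary covering_map_path_lift:
  assumes cov: "covering_map E X p" and g: "pathin X g" and e: "e \<in> topspace E" "p e = g 0"
  obtains d where "pathin E d" "d 0 = e" "\<And>t. t \<in> {0..1} \<Longrightarrow> p (d t) = g t"
proof -
  let ?Y = "discrete_topology {()}"
  have "continuous_map (prod_topology ?Y unit_interval) X (\<lambda>q. g (snd q))"
    using g unfolding pathin_def by (rule continuous_map_compose[OF continuous_map_snd, unfolded o_def])
  then obtain N K where "() \<in> N"
    and K: "continuous_map (prod_topology (subtopology ?Y N) unit_interval) E K"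
      "\<And>n. n \<in> N \<Longrightarrow> K (n, 0) = e"
      "\<And>n t. n \<in> N \<Longrightarrow> t \<in> {0..1} \<Longrightarrow> p (K (n, t)) = g t"
    using e by (elim covering_map_tube_lift[OF cov, where f\<^sub>0 = "\<lambda>_. e" and y = "()"]) auto
  have "continuous_map unit_interval (prod_topology (subtopology ?Y N) unit_interval) (Pair ())"
    using \<open>() \<in> N\<close> by (simp add: continuous_map_pairwise o_def)
  then have "pathin E (\<lambda>t. K ((), t))"
    unfolding pathin_def using K(1) by (rule continuous_map_compose[unfolded o_def])
  with that K(2,3) \<open>() \<in> N\<close> show ?thesis
    by blast
qed

corollary covering_map_path_lift_unique:
  assumes cov: "covering_map E X p" and "pathin E d" "pathin E d'" "d 0 = d' 0"
    and "\<And>t. t \<in> {0..1} \<Longrightarrow> p (d t) = p (d' t)" and "t \<in> {0..1}"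
  shows "d t = d' t"
  using covering_map_unique_lift[OF cov connected_unit_interval, of d d' 0 t] assms(2-)
  by (simp add: pathin_def)

text \<open>Monodromy: the endpoint of the lift depends locally constantly on the homotopy parameter,
  because the lifts of neighbouring paths end in one sheet.\<close>

proposition covering_map_monodromy:
  assumes cov: "covering_map E X p"
    and hom: "homotopic_with (\<lambda>k. k 0 = x \<and> k 1 = x') unit_interval X g g'"
    and d: "pathin E d" "\<And>t. t \<in> {0..1} \<Longrightarrow> p (d t) = g t"
    and d': "pathin E d'" "\<And>t. t \<in> {0..1} \<Longrightarrow> p (d' t) = g' t"
    and start: "d 0 = d' 0"
  shows "d 1 = d' 1"
proof -
  obtain H where H: "continuous_map (prod_topology unit_interval unit_interval) X H"
    and H01: "\<And>t. H (0, t) = g t" "\<And>t. H (1, t) = g' t"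
    and ends: "\<And>s. s \<in> {0..1} \<Longrightarrow> H (s, 0) = x" "\<And>s. s \<in> {0..1} \<Longrightarrow> H (s, 1) = x'"
    using hom unfolding homotopic_with_def by auto
  have d0: "d 0 \<in> topspace E" "p (d 0) = x"
    using continuous_map_funspace[OF d(1)[unfolded pathin_def]] d(2)[of 0] H01(1)[of 0] ends(1)[of 0]
    by auto
  define is_lift where "is_lift s k \<longleftrightarrow>
    pathin E k \<and> k 0 = d 0 \<and> (\<forall>t\<in>{0..1}. p (k t) = H (s, t))" for s k
  have slice: "pathin X (\<lambda>t. H (s, t))" if "s \<in> {0..1}" for s
    unfolding pathin_def using that
    by (intro continuous_map_compose[OF _ H, unfolded o_def]) (auto intro: continuous_intros)
  have ex: "\<exists>k. is_lift s k" if "s \<in> {0..1}" for s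
    using covering_map_path_lift[OF cov slice[OF that] d0(1)] d0(2) ends(1)[OF that]
    unfolding is_lift_def by metis
  have unique: "k t = k' t" if "is_lift s k" "is_lift s k'" "t \<in> {0..1}" for s k k' t
    using that covering_map_path_lift_unique[OF cov, of k k' t] unfolding is_lift_def by simp
  define L where "L s = (SOME k. is_lift s k) 1" for s
  have L: "L s = k 1" if "is_lift s k" for s k
    unfolding L_def using unique[OF someI[of "is_lift s", OF that] that, of 1] by simp
  have "L 0 = L 1"
  proof (rule connected_space_locally_constant[OF connected_unit_interval])
    fix s assume "s \<in> topspace unit_interval"
    then have s: "s \<in> {0..1}" by simp
    obtain N K where N: "openin unit_interval N" "s \<in> N"
      and K: "continuous_map (prod_topology (subtopology unit_interval N) unit_interval) E K"
        "\<And>n. n \<in> N \<Longrightarrow> K (n, 0) = d 0"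
        "\<And>n t. n \<in> N \<Longrightarrow> t \<in> {0..1} \<Longrightarrow> p (K (n, t)) = H (n, t)"
      using covering_map_tube_lift[OF cov H, of "\<lambda>_. d 0" s] s d0 ends(1) by auto
    have N01: "N \<subseteq> {0..1}" "topspace (subtopology unit_interval N) = N"
      using openin_subset[OF N(1)] by auto
    have "pathin E (\<lambda>t. K (n, t))" if "n \<in> N" for n
      unfolding pathin_def using that N01
      by (intro continuous_map_compose[OF _ K(1), unfolded o_def]) (auto simp: continuous_map_pairwise o_def)
    then have LK: "L n = K (n, 1)" if "n \<in> N" for n
      using that K by (intro L) (simp add: is_lift_def)
    have K1: "continuous_map (subtopology unit_interval N) E (\<lambda>n. K (n, 1))"
      by (intro continuous_map_compose[OF _ K(1), unfolded o_def]) (auto simp: continuous_map_pairwise o_def)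
    have "K (s, 1) \<in> topspace E"
      using continuous_map_funspace[OF K1] N(2) N01 by auto
    then obtain T u \<sigma> where u: "K (s, 1) \<in> u" and sh: "sheet E X p T u \<sigma>"
      by (metis covering_map_sheet_at[OF cov])
    let ?U = "{n \<in> topspace (subtopology unit_interval N). K (n, 1) \<in> u}"
    have "openin (subtopology unit_interval N) ?U"
      using sh by (intro openin_continuous_map_preimage[OF K1]) (simp add: sheet_def)
    then have "openin unit_interval ?U"
      using N(1) openin_trans_full by blast
    moreover have "s \<in> ?U"
      using u N(2) N01 by simp
    moreover have "\<forall>n\<in>?U. L n = L s"
    proof
      fix n assume n: "n \<in> ?U"
      then have nN: "n \<in> N" "K (n, 1) \<in> u"
        by auto
      have "p (K (n, 1)) = p (K (s, 1))"
        using K(3)[of n 1] K(3)[of s 1] nN(1) N(2) ends(2)[OF subsetD[OF N01(1)]] by auto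
      then show "L n = L s"
        using sheet_inj[OF sh nN(2) u] LK[OF nN(1)] LK[OF N(2)] by simp
    qed
    ultimately show "\<exists>U. openin unit_interval U \<and> s \<in> U \<and> (\<forall>w\<in>U. L w = L s)"
      by blast
  qed auto
  moreover have "L 0 = d 1" "L 1 = d' 1"
    using d d' start H01 by (auto intro!: L simp: is_lift_def)
  ultimately show ?thesis by simp
qed


section \<open>Paths and simply connected spaces\<close>

lemma pathin_image: "pathin X g \<Longrightarrow> t \<in> {0..1} \<Longrightarrow> g t \<in> topspace X"
  unfolding pathin_def by (erule continuous_map_mem) simp

lemma pathin_o: "pathin X g \<Longrightarrow> continuous_map X Y f \<Longrightarrow> pathin Y (\<lambda>t. f (g t))"
  using pathin_compose[of X g Y f] by (simp add: o_def)

lemma pathin_reparametrise: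
  assumes "pathin X g" "continuous_on {0..1} r" "r ` {0..1} \<subseteq> {0..1}"
  shows "pathin X (\<lambda>t. g (r t))"
proof -
  have "continuous_map unit_interval unit_interval r"
    using assms(2,3) by (auto simp: continuous_map_in_subtopology)
  then show ?thesis
    using assms(1) unfolding pathin_def by (rule continuous_map_compose[unfolded o_def])
qed

lemma pathin_reverse: "pathin X g \<Longrightarrow> pathin X (\<lambda>t. g (1 - t))"
  by (rule pathin_reparametrise) (auto intro!: continuous_intros)

lemma pathin_concat:
  assumes "pathin X g" "pathin X h" "g 1 = h 0"
  shows "pathin X (path_concat g h)"
  unfolding path_concat_def pathin_def
proof (rule continuous_map_cases_le)
  have "continuous_map (subtopology unit_interval {x \<in> topspace unit_interval. x \<le> 1/2}) unit_interval (\<lambda>t. 2 * t)"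
    unfolding subtopology_subtopology
    by (auto simp: continuous_map_in_subtopology intro!: continuous_intros)
  then show "continuous_map (subtopology unit_interval {x \<in> topspace unit_interval. x \<le> 1/2}) X (\<lambda>t. g (2 * t))"
    using assms(1) unfolding pathin_def by (rule continuous_map_compose[unfolded o_def])
  have "continuous_map (subtopology unit_interval {x \<in> topspace unit_interval. 1/2 \<le> x}) unit_interval (\<lambda>t. 2 * t - 1)"
    unfolding subtopology_subtopology
    by (auto simp: continuous_map_in_subtopology intro!: continuous_intros)
  then show "continuous_map (subtopology unit_interval {x \<in> topspace unit_interval. 1/2 \<le> x}) X (\<lambda>t. h (2 * t - 1))"
    using assms(2) unfolding pathin_def by (rule continuous_map_compose[unfolded o_def])
qed (use assms(3) in \<open>auto simp: field_simps\<close>)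

lemma path_concat_ends [simp]: "path_concat g h 0 = g 0" "path_concat g h 1 = h 1"
  by (auto simp: path_concat_def)

lemma simply_connected_path:
  assumes "simply_connected_space Y" "x \<in> topspace Y" "y \<in> topspace Y"
  obtains g where "pathin Y g" "g 0 = x" "g 1 = y"
  using assms unfolding simply_connected_space_def path_connected_space_def by blast

lemma simply_connected_loop_contractible:
  assumes "simply_connected_space Y" "pathin Y g" "g 0 = y" "g 1 = y"
  shows "homotopic_with (\<lambda>k. k 0 = y \<and> k 1 = y) unit_interval Y (\<lambda>_. y) g"
proof -
  have y: "y \<in> topspace Y"
    using pathin_image[OF assms(2), of 0] assms(3) by simp
  then have "carrier (fundamental_group Y y) = {\<one>\<^bsub>fundamental_group Y y\<^esub>}"
    using assms(1) unfolding simply_connected_space_def trivial_group_def by blast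
  then have "loop_class Y y g = loop_class Y y (\<lambda>_. y)"
    using assms unfolding fundamental_group_def loops_def by auto
  moreover have "g \<in> loop_class Y y g"
    using assms by (simp add: loop_class_def pathin_def)
  ultimately show ?thesis
    by (simp add: loop_class_def)
qed

lemma simply_connected_imp_connected: "simply_connected_space Y \<Longrightarrow> connected_space Y"
  by (simp add: simply_connected_space_def path_connected_imp_connected_space)


section \<open>The lifting criterion\<close>

lemma covering_map_lift_end_unique:
  assumes cov: "covering_map E X p" and sc: "simply_connected_space Y" and f: "continuous_map Y X f"
    and a: "pathin Y a" "pathin Y b" "a 0 = b 0" "a 1 = b 1"
    and d: "pathin E d" "\<And>t. t \<in> {0..1} \<Longrightarrow> p (d t) = f (a t)"
    and k: "pathin E k" "\<And>t. t \<in> {0..1} \<Longrightarrow> p (k t) = f (b t)"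
    and start: "d 0 = k 0"
  shows "d 1 = k 1"
proof -
  \<comment> \<open>The lift of \<open>a\<close> followed by the reverse of \<open>b\<close> closes up, since this loop is contractible; so
    its second half, run backwards, is a lift of \<open>b\<close> from the same starting point.\<close>
  let ?l = "path_concat a (\<lambda>t. b (1 - t))"
  have l: "pathin Y ?l"
    using a by (intro pathin_concat pathin_reverse) auto
  obtain q where q: "pathin E q" "q 0 = d 0" "\<And>t. t \<in> {0..1} \<Longrightarrow> p (q t) = f (?l t)"
    using covering_map_path_lift[OF cov pathin_o[OF l f], of "d 0"] pathin_image[OF d(1), of 0] d(2)[of 0]
    by auto
  have "homotopic_with (\<lambda>k. k 0 = f (a 0) \<and> k 1 = f (a 0)) unit_interval X
      (f \<circ> (\<lambda>_. a 0)) (f \<circ> ?l)"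
    using simply_connected_loop_contractible[OF sc l, of "a 0"] a f
    by (intro homotopic_with_compose_continuous_map_left[where p = "\<lambda>k. k 0 = a 0 \<and> k 1 = a 0"]) auto
  moreover have "pathin E (\<lambda>_. d 0)"
    using pathin_image[OF d(1), of 0] by (simp add: pathin_def)
  moreover have "p (d 0) = f (a 0)"
    using d(2)[of 0] by simp
  ultimately have "d 0 = q 1"
    using q by (intro covering_map_monodromy[OF cov, where d = "\<lambda>_. d 0" and d' = q]) (simp_all only: o_def)
  have "d 1 = q (1 * (1/2))"
  proof (rule covering_map_path_lift_unique[OF cov d(1), of "\<lambda>t. q (t * (1/2))"])
    show "pathin E (\<lambda>t. q (t * (1/2)))"
      by (rule pathin_reparametrise[OF q(1)]) (auto intro!: continuous_intros)
  qed (use q d(2) in \<open>auto simp: path_concat_def\<close>)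
  moreover have "k 1 = q (1 - 1 * (1/2))"
  proof (rule covering_map_path_lift_unique[OF cov k(1), of "\<lambda>t. q (1 - t * (1/2))"])
    show "pathin E (\<lambda>t. q (1 - t * (1/2)))"
      by (rule pathin_reparametrise[OF q(1)]) (auto intro!: continuous_intros)
    show "k 0 = q (1 - 0 * (1/2))"
      using \<open>d 0 = q 1\<close> start by simp
    show "p (k t) = p (q (1 - t * (1/2)))" if "t \<in> {0..1}" for t
      using that q(3)[of "1 - t * (1/2)"] k(2)[of t] a(4) by (auto simp: path_concat_def)
  qed auto
  ultimately show ?thesis by simp
qed

text \<open>The lift of \<open>f\<close> at \<open>y\<close> is the endpoint of the lift of the \<open>f\<close>-image of any path from \<open>y\<^sub>0\<close> to \<open>y\<close>.\<close>

theorem covering_map_lifting_criterion: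
  assumes cov: "covering_map E X p" and sc: "simply_connected_space Y"
    and lpc: "locally_path_connected_space Y" and f: "continuous_map Y X f"
    and y0: "y\<^sub>0 \<in> topspace Y" and e0: "e\<^sub>0 \<in> topspace E" "p e\<^sub>0 = f y\<^sub>0"
  obtains F where "continuous_map Y E F" "F y\<^sub>0 = e\<^sub>0" "\<And>y. y \<in> topspace Y \<Longrightarrow> p (F y) = f y"
proof -
  define ends where "ends y e \<longleftrightarrow> (\<exists>a d. pathin Y a \<and> a 0 = y\<^sub>0 \<and> a 1 = y \<and> pathin E d \<and> d 0 = e\<^sub>0 \<and>
    d 1 = e \<and> (\<forall>t\<in>{0..1}. p (d t) = f (a t)))" for y e
  define F where "F y = (SOME e. ends y e)" for y
  have ex: "\<exists>e. ends y e" if "y \<in> topspace Y" for y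
  proof -
    obtain a where a: "pathin Y a" "a 0 = y\<^sub>0" "a 1 = y"
      using simply_connected_path[OF sc y0 \<open>y \<in> topspace Y\<close>] .
    then obtain d where "pathin E d" "d 0 = e\<^sub>0" "\<And>t. t \<in> {0..1} \<Longrightarrow> p (d t) = f (a t)"
      using covering_map_path_lift[OF cov pathin_o[OF a(1) f], of e\<^sub>0] e0 by auto
    with a show ?thesis unfolding ends_def by blast
  qed
  have unique: "e = e'" if "ends y e" "ends y e'" for y e e'
    using that covering_map_lift_end_unique[OF cov sc f] unfolding ends_def by metis
  have F: "F y = e" if "ends y e" for y e
    unfolding F_def using unique[OF someI[of "ends y", OF that] that] .
  have endsF: "ends y (F y)" if "y \<in> topspace Y" for y
    unfolding F_def using ex[OF that] by (rule someI_ex)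
  have FE: "F y \<in> topspace E \<and> p (F y) = f y" if y: "y \<in> topspace Y" for y
  proof -
    obtain a d where "pathin E d" "d 1 = F y" "\<forall>t\<in>{0..1}. p (d t) = f (a t)" "a 1 = y"
      using endsF[OF y] unfolding ends_def by blast
    then show ?thesis
      using pathin_image[of E d 1] by (auto dest: bspec[of _ _ 1])
  qed
  \<comment> \<open>Near a point, \<open>F\<close> is the inverse of \<open>p\<close> on a sheet after \<open>f\<close>.\<close>
  have local: "\<exists>V. openin Y V \<and> y \<in> V \<and> continuous_map (subtopology Y V) E F" if y: "y \<in> topspace Y" for y
  proof -
    obtain T u s where T: "openin X T" "p (F y) \<in> T" and u: "F y \<in> u" and s: "sheet E X p T u s"
      using covering_map_sheet_at[OF cov] FE[OF y] by metis
    have "openin Y {z \<in> topspace Y. f z \<in> T}"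
      using f T(1) by (rule openin_continuous_map_preimage)
    then obtain V where V: "openin Y V" "path_connectedin Y V" "y \<in> V" "V \<subseteq> {z \<in> topspace Y. f z \<in> T}"
      using lpc y T(2) FE[OF y] unfolding locally_path_connected_space
      by (elim allE[of _ "{z \<in> topspace Y. f z \<in> T}"] allE[of _ y]) auto
    have fV: "continuous_map (subtopology Y V) (subtopology X T) f"
      using f V by (auto simp: continuous_map_in_subtopology continuous_map_from_subtopology)
    have sf: "continuous_map (subtopology Y V) E (\<lambda>z. s (f z))"
      using s unfolding sheet_def by (blast intro: continuous_map_compose[OF fV, unfolded o_def])
    have "s (f z) = F z" if z: "z \<in> V" for z
    proof -
      obtain g where g: "pathin (subtopology Y V) g" "g 0 = y" "g 1 = z"
        using V(2,3) z unfolding path_connectedin_def path_connected_space_def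
        by (simp add: Int_absorb1) blast
      then have gY: "pathin Y g" and gV: "\<And>t. t \<in> {0..1} \<Longrightarrow> g t \<in> V"
        by (auto simp: pathin_subtopology)
      obtain a d where a: "pathin Y a" "a 0 = y\<^sub>0" "a 1 = y"
        and d: "pathin E d" "d 0 = e\<^sub>0" "d 1 = F y" "\<forall>t\<in>{0..1}. p (d t) = f (a t)"
        using endsF[OF y] unfolding ends_def by blast
      have sg: "pathin E (\<lambda>t. s (f (g t)))"
        using pathin_o[OF g(1) sf] .
      have sF: "s (f y) = F y"
        using s u FE[OF y] unfolding sheet_def by metis
      have ps: "p (s (f (g r))) = f (g r)" if "r \<in> {0..1}" for r
        using gV[OF that] V(4) s unfolding sheet_def by blast
      then have "\<forall>t\<in>{0..1}. p (path_concat d (\<lambda>t. s (f (g t))) t) = f (path_concat a g t)"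
        using d(4) ps unfolding path_concat_def by auto
      moreover have "pathin Y (path_concat a g)" "pathin E (path_concat d (\<lambda>t. s (f (g t))))"
        using a d gY g sg sF by (auto intro!: pathin_concat)
      ultimately have "ends z (s (f z))"
        unfolding ends_def using a d g
        by (intro exI[of _ "path_concat a g"] exI[of _ "path_concat d (\<lambda>t. s (f (g t)))"]) simp
      then show ?thesis using F by metis
    qed
    then have "continuous_map (subtopology Y V) E F"
      using sf by (rule_tac continuous_map_eq[OF sf]) simp
    with V show ?thesis by blast
  qed
  have "continuous_map Y E F"
  proof (rule pasting_lemma[where f = "\<lambda>_. F" and T = id and I = "{V. openin Y V \<and> continuous_map (subtopology Y V) E F}"])
    show "\<exists>j. j \<in> {V. openin Y V \<and> continuous_map (subtopology Y V) E F} \<and> x \<in> id j \<and> F x = F x"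
      if "x \<in> topspace Y" for x
      using local[OF that] by auto
  qed auto
  moreover have "F y\<^sub>0 = e\<^sub>0"
  proof (rule F)
    have "pathin Y (\<lambda>_. y\<^sub>0)" "pathin E (\<lambda>_. e\<^sub>0)"
      using y0 e0 by (auto simp: pathin_def)
    then show "ends y\<^sub>0 e\<^sub>0"
      unfolding ends_def using e0 by (intro exI[of _ "\<lambda>_. y\<^sub>0"] exI[of _ "\<lambda>_. e\<^sub>0"]) simp
  qed
  ultimately show ?thesis
    using that FE by blast
qed

text \<open>The lift of \<open>f'\<close> that takes \<open>e'\<close> back to \<open>e\<close> is inverse to the lift of \<open>f\<close>: both composites lift
  \<open>p\<close> and fix a point, so they are the identity by uniqueness of lifts.\<close>

corollary universal_covering_lift_homeomorphism:
  assumes uc: "universal_covering E X p" and f: "homeomorphic_maps X X f f'"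
    and e: "e \<in> topspace E" "e' \<in> topspace E" "p e' = f (p e)"
  obtains F F' where "homeomorphic_maps E E F F'" "F e = e'"
    "\<And>d. d \<in> topspace E \<Longrightarrow> p (F d) = f (p d)"
    "\<And>d. d \<in> topspace E \<Longrightarrow> p (F' d) = f' (p d)"
proof -
  have cov: "covering_map E X p" and sc: "simply_connected_space E"
    and lpc: "locally_path_connected_space E"
    using uc unfolding universal_covering_def by auto
  have p: "continuous_map E X p" and pX: "\<And>d. d \<in> topspace E \<Longrightarrow> p d \<in> topspace X"
    using cov unfolding covering_map_def by auto
  have cf: "continuous_map X X f" "continuous_map X X f'"
    and ff: "\<And>x. x \<in> topspace X \<Longrightarrow> f' (f x) = x" "\<And>x. x \<in> topspace X \<Longrightarrow> f (f' x) = x"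
    using f unfolding homeomorphic_maps_def by auto
  have e'': "p e = f' (p e')"
    using ff(1) pX e by simp
  obtain F where F: "continuous_map E E F" "F e = e'" "\<And>d. d \<in> topspace E \<Longrightarrow> p (F d) = f (p d)"
    using covering_map_lifting_criterion[OF cov sc lpc continuous_map_compose[OF p cf(1)] e(1,2)] e(3)
    by auto
  obtain F' where F': "continuous_map E E F'" "F' e' = e" "\<And>d. d \<in> topspace E \<Longrightarrow> p (F' d) = f' (p d)"
    using covering_map_lifting_criterion[OF cov sc lpc continuous_map_compose[OF p cf(2)] e(2,1)] e''
    by auto
  have FE: "F d \<in> topspace E" "F' d \<in> topspace E" if "d \<in> topspace E" for d
    using F(1) F'(1) that by (auto dest: continuous_map_funspace)
  have conn: "connected_space E"
    using sc by (rule simply_connected_imp_connected)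
  have "F' (F d) = d" if "d \<in> topspace E" for d
    using covering_map_unique_lift[OF cov conn continuous_map_compose[OF F(1) F'(1)] continuous_map_id, of e d]
      F F' FE e that pX ff by simp
  moreover have "F (F' d) = d" if "d \<in> topspace E" for d
    using covering_map_unique_lift[OF cov conn continuous_map_compose[OF F'(1) F(1)] continuous_map_id, of e' d]
      F F' FE e that pX ff by simp
  ultimately have "homeomorphic_maps E E F F'"
    unfolding homeomorphic_maps_def using F F' by simp
  then show ?thesis
    using that F F' by blast
qed


section \<open>Singular one-cocycles evaluated on paths\<close>

definition path_value :: "('a chain \<Rightarrow> 'k) \<Rightarrow> (real \<Rightarrow> 'a) \<Rightarrow> 'k"
  where "path_value \<phi> g = \<phi> (frag_of (path_simplex g))"

definition point_simplex :: "'a \<Rightarrow> (nat \<Rightarrow> real) \<Rightarrow> 'a"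
  where "point_simplex x = restrict (\<lambda>_. x) (standard_simplex 0)"

lemma path_simplex_cong:
  assumes "\<And>t. t \<in> {0..1} \<Longrightarrow> g t = h t"
  shows "path_simplex g = path_simplex h"
  unfolding path_simplex_def
  by (rule restrict_ext) (use assms in \<open>auto simp: standard_simplex_def\<close>)

lemma path_value_cong: "(\<And>t. t \<in> {0..1} \<Longrightarrow> g t = h t) \<Longrightarrow> path_value \<phi> g = path_value \<phi> h"
  unfolding path_value_def using path_simplex_cong by metis

lemma singular_simplex_path_simplex:
  assumes "pathin X g"
  shows "singular_simplex 1 X (path_simplex g)"
proof -
  have "continuous_map (subtopology (powertop_real UNIV) (standard_simplex 1)) unit_interval (\<lambda>v. v 1)"
    unfolding continuous_map_in_subtopology
    by (auto simp: standard_simplex_def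
        intro!: continuous_map_from_subtopology continuous_map_product_projection)
  then have "continuous_map (subtopology (powertop_real UNIV) (standard_simplex 1)) X (\<lambda>v. g (v 1))"
    using assms unfolding pathin_def by (rule continuous_map_compose[unfolded o_def])
  then show ?thesis
    unfolding singular_simplex_def path_simplex_def
    by (auto intro: continuous_map_eq)
qed

text \<open>A cochain is determined by its values on simplices, so it suffices to compare one-cochains on
  paths.\<close>

lemma singular_simplex_1_path:
  assumes "singular_simplex 1 X \<sigma>"
  obtains g where "pathin X g" "\<sigma> = path_simplex g"
proof -
  let ?r = "\<lambda>t i. if i = 0 then 1 - t else if i = 1 then t else (0::real)"
  have r: "?r t \<in> standard_simplex 1" if "t \<in> {0..1}" for t :: real
    using that by (auto simp: standard_simplex_def)
  have "continuous_map unit_interval (powertop_real UNIV) ?r"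
    unfolding continuous_map_componentwise_UNIV
  proof
    fix k show "continuous_map unit_interval euclideanreal (\<lambda>x. ?r x k)"
      by (cases "k = 0"; cases "k = 1") (auto intro!: continuous_intros)
  qed
  then have "continuous_map unit_interval (subtopology (powertop_real UNIV) (standard_simplex 1)) ?r"
    unfolding continuous_map_in_subtopology using r by auto
  then have "pathin X (\<lambda>t. \<sigma> (?r t))"
    unfolding pathin_def
    using assms singular_simplex_def continuous_map_compose[of _ _ ?r X \<sigma>, unfolded o_def] by blast
  moreover have "\<sigma> = path_simplex (\<lambda>t. \<sigma> (?r t))"
  proof
    fix v show "\<sigma> v = path_simplex (\<lambda>t. \<sigma> (?r t)) v"
    proof (cases "v \<in> standard_simplex 1")
      case True
      then have "v 0 + v 1 = 1" "\<And>i. i > 1 \<Longrightarrow> v i = 0"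
        by (auto simp: standard_simplex_def)
      then have "?r (v 1) = v"
        by (auto simp: fun_eq_iff)
      with True show ?thesis
        by (simp add: path_simplex_def)
    next
      case False
      then show ?thesis
        using assms by (simp add: path_simplex_def singular_simplex_def extensional_def)
    qed
  qed
  ultimately show ?thesis
    using that by blast
qed

lemma singular_face_path_simplex:
  "singular_face 1 0 (path_simplex g) = point_simplex (g 1)"
  "singular_face 1 1 (path_simplex g) = point_simplex (g 0)"
proof -
  have "simplical_face 0 v \<in> standard_simplex 1" "simplical_face 1 v \<in> standard_simplex 1"
    if "v \<in> standard_simplex 0" for v :: "nat \<Rightarrow> real"
    using simplical_face_in_standard_simplex[of 1 _ v] that by auto
  then show "singular_face 1 0 (path_simplex g) = point_simplex (g 1)"
    "singular_face 1 1 (path_simplex g) = point_simplex (g 0)"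
    by (auto simp: singular_face_def path_simplex_def point_simplex_def simplical_face_def
        standard_simplex_0 intro!: restrict_ext)
qed

lemma chain_boundary_path_simplex:
  "chain_boundary 1 (frag_of (path_simplex g)) =
    frag_of (point_simplex (g 1)) - frag_of (point_simplex (g 0))"
  by (simp add: chain_boundary_of singular_face_path_simplex[simplified])

lemma singular_simplex_point_simplex:
  "x \<in> topspace X \<Longrightarrow> singular_simplex 0 X (point_simplex x)"
  unfolding singular_simplex_def point_simplex_def
  by (auto intro: continuous_map_eq[where f = "\<lambda>_. x"])

lemma cochain_add:
  "\<lbrakk>\<phi> \<in> cochains p X; singular_chain p X a; singular_chain p X b\<rbrakk> \<Longrightarrow> \<phi> (a + b) = \<phi> a + \<phi> b"
  unfolding cochains_def by blast

lemma cochain_0: "\<phi> \<in> cochains p X \<Longrightarrow> \<phi> 0 = 0"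
  using cochain_add[of \<phi> p X 0 0] by simp

lemma cochain_diff:
  assumes "\<phi> \<in> cochains p X" "singular_chain p X a" "singular_chain p X b"
  shows "\<phi> (a - b) = \<phi> a - \<phi> b"
  using cochain_add[OF assms(1) singular_chain_diff[OF assms(2,3)] assms(3)] by simp

lemma cochain_outside: "\<phi> \<in> cochains p X \<Longrightarrow> \<not> singular_chain p X a \<Longrightarrow> \<phi> a = 0"
  unfolding cochains_def by blast

lemma cochain_eqI:
  assumes "\<phi> \<in> cochains p X" "\<psi> \<in> cochains p X"
    and eq: "\<And>\<sigma>. singular_simplex p X \<sigma> \<Longrightarrow> \<phi> (frag_of \<sigma>) = \<psi> (frag_of \<sigma>)"
  shows "\<phi> = \<psi>"
proof
  fix a show "\<phi> a = \<psi> a"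
  proof (cases "singular_chain p X a")
    case True
    then have "Poly_Mapping.keys a \<subseteq> {\<sigma>. singular_simplex p X \<sigma>}"
      by (simp add: singular_chain_def)
    then have "singular_chain p X a \<and> \<phi> a = \<psi> a"
    proof (induction rule: frag_induction)
      case zero
      show ?case using assms by (simp add: cochain_0)
    next
      case (one x)
      then show ?case using eq by (simp add: singular_chain_of)
    next
      case (diff a b)
      then show ?case using assms by (simp add: cochain_diff singular_chain_diff)
    qed
    then show ?thesis by simp
  qed (use assms in \<open>simp add: cochain_outside\<close>)
qed

lemma coboundary_cochain:
  assumes "\<phi> \<in> cochains p X"
  shows "coboundary p X \<phi> \<in> cochains (Suc p) X"
  using cochain_add[OF assms singular_chain_boundary_alt singular_chain_boundary_alt]
  unfolding cochains_def coboundary_def by (auto simp: chain_boundary_add singular_chain_add)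

lemma cochains_combine:
  assumes "\<phi> \<in> cochains p X" "\<psi> \<in> cochains p X"
  shows "(\<lambda>a. \<phi> a + \<psi> a) \<in> cochains p X" "(\<lambda>a. \<phi> a - \<psi> a) \<in> cochains p X"
  using assms unfolding cochains_def by auto

lemma cocycles_diff:
  assumes "\<phi> \<in> cocycles p X" "\<psi> \<in> cocycles p X"
  shows "(\<lambda>a. \<phi> a - \<psi> a) \<in> cocycles p X"
  using assms cochains_combine(2)[of \<phi> p X \<psi>]
  unfolding cocycles_def coboundary_def by (auto simp: fun_eq_iff split: if_splits)

lemma cocycle_boundary:
  assumes "\<phi> \<in> cocycles p X" "singular_chain (Suc p) X d"
  shows "\<phi> (chain_boundary (Suc p) d) = 0"
  using assms unfolding cocycles_def coboundary_def by (auto simp: fun_eq_iff split: if_splits)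

lemma path_value_coboundary:
  assumes "\<kappa> \<in> cochains 0 X" "pathin X g"
  shows "path_value (coboundary 0 X \<kappa>) g =
    \<kappa> (frag_of (point_simplex (g 1))) - \<kappa> (frag_of (point_simplex (g 0)))"
proof -
  have "singular_chain 0 X (frag_of (point_simplex (g t)))" if "t \<in> {0..1}" for t
    using pathin_image[OF assms(2) that] by (simp add: singular_chain_of singular_simplex_point_simplex)
  then show ?thesis
    using singular_simplex_path_simplex[OF assms(2)]
    by (simp add: path_value_def coboundary_def singular_chain_of
        chain_boundary_path_simplex[simplified] cochain_diff[OF assms(1)])
qed

text \<open>All rules for the value of a cocycle on paths come from this one: an affine triangle in a convex
  set is filled by a singular two-simplex, on whose boundary the cocycle vanishes. Degenerate
  triangles are allowed.\<close>

lemma path_value_triangle: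
  fixes \<tau> :: "'v::real_normed_vector \<Rightarrow> 'a"
  assumes \<phi>: "\<phi> \<in> cocycles 1 X" and \<tau>: "continuous_map (top_of_set S) X \<tau>"
    and S: "convex S" "A \<in> S" "B \<in> S" "C \<in> S"
  shows "path_value \<phi> (\<lambda>t. \<tau> (linepath A C t)) =
    path_value \<phi> (\<lambda>t. \<tau> (linepath A B t)) + path_value \<phi> (\<lambda>t. \<tau> (linepath B C t))"
proof -
  define m where "m v = v 0 *\<^sub>R A + v 1 *\<^sub>R B + v 2 *\<^sub>R C" for v :: "nat \<Rightarrow> real"
  define \<sigma> where "\<sigma> = restrict (\<lambda>v. \<tau> (m v)) (standard_simplex 2)"
  have mS: "m v \<in> S" if "v \<in> standard_simplex 2" for v
  proof -
    have "v 0 + v 1 + v 2 = 1" "\<forall>i. 0 \<le> v i"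
      using that by (auto simp: standard_simplex_def numeral_2_eq_2)
    then have "(\<Sum>i\<in>{0,1,2}. v i *\<^sub>R (if i = 0 then A else if i = 1 then B else C)) \<in> S"
      using S by (intro convex_sum) auto
    then show ?thesis
      by (simp add: m_def add.assoc)
  qed
  have "continuous_on (standard_simplex 2) m"
    unfolding m_def by (intro continuous_intros continuous_on_subset[OF continuous_on_product_coordinates]) auto
  then have "continuous_map (subtopology (powertop_real UNIV) (standard_simplex 2)) (top_of_set S) m"
    using mS by (auto simp: euclidean_product_topology continuous_map_in_subtopology)
  then have "continuous_map (subtopology (powertop_real UNIV) (standard_simplex 2)) X (\<lambda>v. \<tau> (m v))"
    using \<tau> by (rule continuous_map_compose[unfolded o_def])
  then have \<sigma>: "singular_simplex 2 X \<sigma>"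
    unfolding singular_simplex_def \<sigma>_def by (auto intro: continuous_map_eq)
  have faces: "singular_face 2 0 \<sigma> = path_simplex (\<lambda>t. \<tau> (linepath B C t))"
    "singular_face 2 1 \<sigma> = path_simplex (\<lambda>t. \<tau> (linepath A C t))"
    "singular_face 2 2 \<sigma> = path_simplex (\<lambda>t. \<tau> (linepath A B t))"
  proof -
    have v: "v 0 = 1 - v 1" if "v \<in> standard_simplex 1" for v :: "nat \<Rightarrow> real"
      using that by (auto simp: standard_simplex_def)
    have f: "simplical_face k v \<in> standard_simplex 2"
      if "v \<in> standard_simplex 1" "k \<le> 2" for v :: "nat \<Rightarrow> real" and k
      using simplical_face_in_standard_simplex[of 2 k v] that by simp
    have \<sigma>f: "\<sigma> (simplical_face k v) = \<tau> (m (simplical_face k v))"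
      if "v \<in> standard_simplex 1" "k \<le> 2" for v k
      using f[OF that] by (simp add: \<sigma>_def)
    have mf: "m (simplical_face 0 v) = linepath B C (v 1)" "m (simplical_face 1 v) = linepath A C (v 1)"
      "m (simplical_face 2 v) = linepath A B (v 1)" if "v \<in> standard_simplex 1" for v
      using v[OF that] by (simp_all add: m_def simplical_face_def linepath_def)
    show "singular_face 2 0 \<sigma> = path_simplex (\<lambda>t. \<tau> (linepath B C t))"
      "singular_face 2 1 \<sigma> = path_simplex (\<lambda>t. \<tau> (linepath A C t))"
      "singular_face 2 2 \<sigma> = path_simplex (\<lambda>t. \<tau> (linepath A B t))"
      unfolding singular_face_def path_simplex_def
      by (auto simp: \<sigma>f[simplified] mf[simplified] intro!: restrict_ext)
  qed
  have "linepath P Q ` {0..1} \<subseteq> S" if "P \<in> S" "Q \<in> S" for P Q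
    using that S(1) by (metis closed_segment_subset linepath_image_01)
  then have "pathin X (\<lambda>t. \<tau> (linepath P Q t))" if "P \<in> S" "Q \<in> S" for P Q
    unfolding pathin_def using that
    by (intro continuous_map_compose[OF _ \<tau>, unfolded o_def]) (auto simp: continuous_map_in_subtopology)
  then have ch: "singular_chain 1 X (frag_of (path_simplex (\<lambda>t. \<tau> (linepath P Q t))))"
    if "P \<in> S" "Q \<in> S" for P Q
    using that by (simp add: singular_chain_of singular_simplex_path_simplex[simplified])
  have "chain_boundary 2 (frag_of \<sigma>) = frag_of (path_simplex (\<lambda>t. \<tau> (linepath B C t)))
      - frag_of (path_simplex (\<lambda>t. \<tau> (linepath A C t))) + frag_of (path_simplex (\<lambda>t. \<tau> (linepath A B t)))"
    using faces by (simp add: chain_boundary_of numeral_2_eq_2)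
  then have vanish: "\<phi> (frag_of (path_simplex (\<lambda>t. \<tau> (linepath B C t)))
      - frag_of (path_simplex (\<lambda>t. \<tau> (linepath A C t))) + frag_of (path_simplex (\<lambda>t. \<tau> (linepath A B t)))) = 0"
    using cocycle_boundary[OF \<phi>, of "frag_of \<sigma>"] \<sigma>
    by (simp only: singular_chain_of numeral_2_eq_2 One_nat_def)
  have \<phi>c: "\<phi> \<in> cochains 1 X"
    using \<phi> by (simp add: cocycles_def)
  have "\<phi> (frag_of (path_simplex (\<lambda>t. \<tau> (linepath B C t)))
      - frag_of (path_simplex (\<lambda>t. \<tau> (linepath A C t))) + frag_of (path_simplex (\<lambda>t. \<tau> (linepath A B t)))) =
    path_value \<phi> (\<lambda>t. \<tau> (linepath B C t)) - path_value \<phi> (\<lambda>t. \<tau> (linepath A C t))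
      + path_value \<phi> (\<lambda>t. \<tau> (linepath A B t))"
    by (simp only: path_value_def cochain_add[OF \<phi>c] cochain_diff[OF \<phi>c] ch S singular_chain_diff)
  then have "path_value \<phi> (\<lambda>t. \<tau> (linepath B C t)) - path_value \<phi> (\<lambda>t. \<tau> (linepath A C t))
      + path_value \<phi> (\<lambda>t. \<tau> (linepath A B t)) = 0"
    by (simp only: vanish)
  then show ?thesis
    by (simp add: algebra_simps)
qed

lemma path_value_const:
  assumes "\<phi> \<in> cocycles 1 X" "x \<in> topspace X"
  shows "path_value \<phi> (\<lambda>_. x) = 0"
  using path_value_triangle[OF assms(1), of UNIV "\<lambda>_. x" "0::real" 0 0] assms(2) by simp

text \<open>The triangle with vertices 0, 1/2, 1 on the line.\<close>

lemma path_value_concat: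
  assumes "\<phi> \<in> cocycles 1 X" "pathin X g" "pathin X h" "g 1 = h 0"
  shows "path_value \<phi> (path_concat g h) = path_value \<phi> g + path_value \<phi> h"
proof -
  let ?k = "path_concat g h"
  have "path_value \<phi> (\<lambda>t. ?k (linepath 0 1 t)) =
    path_value \<phi> (\<lambda>t. ?k (linepath 0 (1/2) t)) + path_value \<phi> (\<lambda>t. ?k (linepath (1/2) 1 t))"
    using pathin_concat[OF assms(2-4)]
    by (intro path_value_triangle[OF assms(1), of "{0..1}"]) (auto simp: pathin_def)
  moreover have "path_value \<phi> (\<lambda>t. ?k (linepath 0 1 t)) = path_value \<phi> ?k"
    by (simp add: linepath_def)
  moreover have "path_value \<phi> (\<lambda>t. ?k (linepath 0 (1/2) t)) = path_value \<phi> g"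
    by (rule path_value_cong) (auto simp: linepath_def path_concat_def)
  moreover have "path_value \<phi> (\<lambda>t. ?k (linepath (1/2) 1 t)) = path_value \<phi> h"
  proof (rule path_value_cong)
    fix t :: real assume "t \<in> {0..1}"
    then show "?k (linepath (1/2) 1 t) = h t"
      using assms(4) by (cases "t = 0") (auto simp: linepath_def path_concat_def field_simps)
  qed
  ultimately show ?thesis by simp
qed

text \<open>The triangle with vertices 0, 1, 0 on the line.\<close>

lemma path_value_reverse:
  assumes "\<phi> \<in> cocycles 1 X" "pathin X g"
  shows "path_value \<phi> (\<lambda>t. g (1 - t)) = - path_value \<phi> g"
proof -
  have "path_value \<phi> (\<lambda>t. g (linepath 0 0 t)) =
    path_value \<phi> (\<lambda>t. g (linepath 0 1 t)) + path_value \<phi> (\<lambda>t. g (linepath 1 0 t))"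
    using assms by (intro path_value_triangle[OF assms(1), of "{0..1}"]) (auto simp: pathin_def)
  moreover have "path_value \<phi> (\<lambda>t. g (linepath 0 0 t)) = 0"
    using path_value_const[OF assms(1) pathin_image[OF assms(2), of 0]] by (simp add: linepath_def)
  ultimately have "path_value \<phi> g + path_value \<phi> (\<lambda>t. g (1 - t)) = 0"
    by (simp add: linepath_def)
  then show ?thesis by (metis minus_unique)
qed

lemma path_value_homotopic:
  assumes \<phi>: "\<phi> \<in> cocycles 1 X"
    and "homotopic_with (\<lambda>k. k 0 = x \<and> k 1 = y) unit_interval X g h"
  shows "path_value \<phi> g = path_value \<phi> h"
proof -
  obtain H where H: "continuous_map (top_of_set ({0..1::real} \<times> {0..1::real})) X H"
    and H01: "\<And>t. H (0, t) = g t" "\<And>t. H (1, t) = h t"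
    and ends: "\<And>s. s \<in> {0..1} \<Longrightarrow> H (s, 0) = x" "\<And>s. s \<in> {0..1} \<Longrightarrow> H (s, 1) = y"
    using assms(2) unfolding homotopic_with_def by auto
  have xy: "x \<in> topspace X" "y \<in> topspace X"
    using continuous_map_mem[OF H, of "(0,0)"] continuous_map_mem[OF H, of "(0,1)"] ends[of 0] by auto
  \<comment> \<open>The diagonal cuts the square into two triangles.\<close>
  let ?e = "\<lambda>A B. path_value \<phi> (\<lambda>t. H (linepath A B t))"
  have tri: "?e (0,0) (1,1) = ?e (0,0) B + ?e B (1,1)" if "B \<in> {0..1} \<times> {0..1}" for B
    using that by (intro path_value_triangle[OF \<phi> H]) (auto intro!: convex_Times)
  have "?e (0,0) (0,1) = path_value \<phi> g" "?e (1,0) (1,1) = path_value \<phi> h"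
    by (simp_all add: linepath_def H01)
  moreover have "?e (0,1) (1,1) = path_value \<phi> (\<lambda>_. y)" "?e (0,0) (1,0) = path_value \<phi> (\<lambda>_. x)"
    by (rule path_value_cong; simp add: linepath_def ends)+
  ultimately show ?thesis
    using tri[of "(0,1)"] tri[of "(1,0)"] path_value_const[OF \<phi>] xy by simp
qed

lemma path_connected_space_paths_from:
  assumes "path_connected_space X" "x \<in> topspace X"
  obtains a where "\<And>y. y \<in> topspace X \<Longrightarrow> pathin X (a y)"
    "\<And>y. y \<in> topspace X \<Longrightarrow> a y 0 = x" "\<And>y. y \<in> topspace X \<Longrightarrow> a y 1 = y"
proof -
  have "\<forall>y\<in>topspace X. \<exists>g. pathin X g \<and> g 0 = x \<and> g 1 = y"
    using assms unfolding path_connected_space_def by blast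
  then show ?thesis
    using that by (auto dest!: bchoice)
qed

text \<open>The value on a path from a fixed base point depends only on the endpoint of the path.\<close>

lemma cocycle_primitive:
  assumes \<phi>: "\<phi> \<in> cocycles 1 X" and pc: "path_connected_space X"
    and loops: "\<And>g. pathin X g \<Longrightarrow> g 0 = g 1 \<Longrightarrow> path_value \<phi> g = 0"
  obtains k where "\<And>g. pathin X g \<Longrightarrow> path_value \<phi> g = k (g 1) - k (g 0)"
proof (cases "topspace X = {}")
  case True
  then show ?thesis
    using that pathin_image[of X _ 0] by force
next
  case False
  then obtain x where x: "x \<in> topspace X" by blast
  then obtain a where a: "\<And>y. y \<in> topspace X \<Longrightarrow> pathin X (a y)"
      "\<And>y. y \<in> topspace X \<Longrightarrow> a y 0 = x" "\<And>y. y \<in> topspace X \<Longrightarrow> a y 1 = y"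
    using path_connected_space_paths_from[OF pc] by blast
  have "path_value \<phi> g = path_value \<phi> (a (g 1)) - path_value \<phi> (a (g 0))" if g: "pathin X g" for g
  proof -
    have g01: "g 0 \<in> topspace X" "g 1 \<in> topspace X"
      using pathin_image[OF g] by auto
    let ?b = "path_concat (a (g 0)) g" and ?r = "\<lambda>t. a (g 1) (1 - t)"
    have b: "pathin X ?b" and r: "pathin X ?r"
      using a[OF g01(1)] a[OF g01(2)] g by (auto intro: pathin_concat pathin_reverse)
    have "path_value \<phi> (path_concat ?b ?r) = 0"
      using a[OF g01(1)] a[OF g01(2)] by (intro loops pathin_concat[OF b r]) auto
    moreover have "path_value \<phi> (path_concat ?b ?r) = path_value \<phi> (a (g 0)) + path_value \<phi> g - path_value \<phi> (a (g 1))"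
      using a[OF g01(1)] a[OF g01(2)] b r g
      by (simp add: path_value_concat[OF \<phi>] path_value_reverse[OF \<phi>])
    ultimately show ?thesis
      by (simp add: algebra_simps)
  qed
  then show ?thesis
    by (rule that)
qed

text \<open>This is the injectivity of the map from \<open>H\<^sup>1(X; A)\<close> to \<open>Hom(\<pi>\<^sub>1(X), A)\<close>. The zero-cochain whose
  coboundary is \<open>\<phi>\<close> evaluates \<open>\<phi>\<close> on paths from a base point.\<close>

lemma cocycle_coboundary_iff:
  fixes X :: "'a topology"
  assumes \<phi>: "\<phi> \<in> cocycles 1 X" and pc: "path_connected_space X"
  shows "\<phi> \<in> coboundaries 1 X \<longleftrightarrow> (\<forall>g. pathin X g \<longrightarrow> g 0 = g 1 \<longrightarrow> path_value \<phi> g = 0)"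
proof
  assume "\<phi> \<in> coboundaries 1 X"
  then obtain \<kappa> where "\<kappa> \<in> cochains 0 X" "\<phi> = coboundary 0 X \<kappa>"
    by (auto simp: coboundaries_def)
  then show "\<forall>g. pathin X g \<longrightarrow> g 0 = g 1 \<longrightarrow> path_value \<phi> g = 0"
    by (simp add: path_value_coboundary)
next
  assume loops: "\<forall>g. pathin X g \<longrightarrow> g 0 = g 1 \<longrightarrow> path_value \<phi> g = 0"
  show "\<phi> \<in> coboundaries 1 X"
  proof (cases "topspace X = {}")
    case True
    have "\<phi> = coboundary 0 X (\<lambda>_. 0)"
    proof (rule cochain_eqI)
      show "\<phi> \<in> cochains 1 X" "coboundary 0 X (\<lambda>_. 0) \<in> cochains 1 X"
        using \<phi> coboundary_cochain[of "\<lambda>_. 0" 0 X] by (auto simp: cocycles_def cochains_def)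
    qed (use True singular_simplex_empty in blast)
    moreover have "(\<lambda>_. 0) \<in> cochains 0 X"
      by (simp add: cochains_def)
    ultimately show ?thesis
      by (auto simp: coboundaries_def)
  next
    case False
    then obtain x where x: "x \<in> topspace X" by blast
    then obtain a where a: "\<And>y. y \<in> topspace X \<Longrightarrow> pathin X (a y)"
        "\<And>y. y \<in> topspace X \<Longrightarrow> a y 0 = x" "\<And>y. y \<in> topspace X \<Longrightarrow> a y 1 = y"
      using path_connected_space_paths_from[OF pc] by blast
    obtain k where k: "\<And>g. pathin X g \<Longrightarrow> path_value \<phi> g = k (g 1) - k (g 0)"
      using cocycle_primitive[OF \<phi> pc] loops by metis
    \<comment> \<open>Joining each point to the base point by a path makes a zero-chain into a one-chain.\<close>
    define cone :: "'a chain \<Rightarrow> 'a chain" where "cone = frag_extend (\<lambda>\<sigma>. frag_of (path_simplex (a (\<sigma> (\<lambda>j. if j = 0 then 1 else 0)))))"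
    define \<kappa> where "\<kappa> b = (if singular_chain 0 X b then \<phi> (cone b) else 0)" for b
    have pt: "\<sigma> (\<lambda>j. if j = 0 then 1 else 0) \<in> topspace X" if "singular_simplex 0 X \<sigma>" for \<sigma>
      using that continuous_map_mem unfolding singular_simplex_def by fastforce
    have cone: "singular_chain 1 X (cone b)" if "singular_chain 0 X b" for b
      unfolding cone_def
    proof (rule singular_chain_extend)
      fix \<sigma> assume "\<sigma> \<in> Poly_Mapping.keys b"
      then have "singular_simplex 0 X \<sigma>"
        using that by (auto simp: singular_chain_def)
      then show "singular_chain 1 X (frag_of (path_simplex (a (\<sigma> (\<lambda>j. if j = 0 then 1 else 0)))))"
        using a(1)[OF pt] by (simp add: singular_chain_of singular_simplex_path_simplex[simplified])
    qed
    have \<phi>c: "\<phi> \<in> cochains 1 X"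
      using \<phi> by (simp add: cocycles_def)
    have \<kappa>c: "\<kappa> \<in> cochains 0 X"
    proof -
      have "\<kappa> (b + b') = \<kappa> b + \<kappa> b'" if "singular_chain 0 X b" "singular_chain 0 X b'" for b b'
        using that cochain_add[OF \<phi>c cone[OF that(1)] cone[OF that(2)]]
        by (simp add: \<kappa>_def singular_chain_add cone_def frag_extend_add)
      then show ?thesis
        unfolding cochains_def by (simp add: \<kappa>_def)
    qed
    have \<kappa>pt: "\<kappa> (frag_of (point_simplex y)) = k y - k x" if "y \<in> topspace X" for y
      using that k[OF a(1)[OF that]] a(2,3)[OF that]
      by (simp add: \<kappa>_def cone_def singular_chain_of singular_simplex_point_simplex path_value_def)
        (simp add: point_simplex_def)
    have "\<phi> = coboundary 0 X \<kappa>"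
    proof (rule cochain_eqI[OF \<phi>c])
      show "coboundary 0 X \<kappa> \<in> cochains 1 X"
        using coboundary_cochain[OF \<kappa>c] by simp
      fix \<sigma> assume "singular_simplex 1 X \<sigma>"
      then obtain g where g: "pathin X g" "\<sigma> = path_simplex g"
        by (rule singular_simplex_1_path)
      have "path_value \<phi> g = path_value (coboundary 0 X \<kappa>) g"
        using pathin_image[OF g(1)] by (simp add: path_value_coboundary[OF \<kappa>c g(1)] \<kappa>pt k[OF g(1)])
      then show "\<phi> (frag_of \<sigma>) = coboundary 0 X \<kappa> (frag_of \<sigma>)"
        by (simp add: path_value_def g(2))
    qed
    then show ?thesis
      using \<kappa>c by (auto simp: coboundaries_def)
  qed
qed


section \<open>Classes in degree one\<close>

lemma coboundaries_combine:
  assumes "\<beta> \<in> coboundaries (Suc p) X" "\<gamma> \<in> coboundaries (Suc p) X"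
  shows "(\<lambda>a. \<beta> a + \<gamma> a) \<in> coboundaries (Suc p) X" "(\<lambda>a. \<beta> a - \<gamma> a) \<in> coboundaries (Suc p) X"
proof -
  from assms obtain \<kappa> \<mu> where "\<kappa> \<in> cochains p X" "\<beta> = coboundary p X \<kappa>" "\<mu> \<in> cochains p X" "\<gamma> = coboundary p X \<mu>"
    by (auto simp: coboundaries_def)
  moreover from this have "(\<lambda>a. \<beta> a + \<gamma> a) = coboundary p X (\<lambda>a. \<kappa> a + \<mu> a)"
    "(\<lambda>a. \<beta> a - \<gamma> a) = coboundary p X (\<lambda>a. \<kappa> a - \<mu> a)"
    by (auto simp: coboundary_def)
  ultimately show "(\<lambda>a. \<beta> a + \<gamma> a) \<in> coboundaries (Suc p) X" "(\<lambda>a. \<beta> a - \<gamma> a) \<in> coboundaries (Suc p) X"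
    using cochains_combine[of \<kappa> p X \<mu>] by (auto simp: coboundaries_def)
qed

lemma coboundaries_0: "(\<lambda>_. 0) \<in> coboundaries (Suc p) X"
proof -
  have "(\<lambda>_. 0) = coboundary p X (\<lambda>_. 0)" "(\<lambda>_. 0) \<in> cochains p X"
    by (auto simp: coboundary_def cochains_def)
  then show ?thesis by (auto simp: coboundaries_def)
qed

text \<open>The quotient group is handled through representatives throughout: a class is the set of functions
  that differ from a representative by a coboundary.\<close>

lemma cohomology_class_iff:
  "\<psi> \<in> cohomology_class p X \<phi> \<longleftrightarrow> (\<lambda>a. \<psi> a - \<phi> a) \<in> coboundaries p X"
proof
  assume "\<psi> \<in> cohomology_class p X \<phi>"
  then obtain \<beta> where "\<beta> \<in> coboundaries p X" "\<psi> = (\<lambda>a. \<beta> a + \<phi> a)"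
    by (auto simp: cohomology_class_def r_coset_def cocycle_group_def)
  then show "(\<lambda>a. \<psi> a - \<phi> a) \<in> coboundaries p X"
    by simp
next
  assume "(\<lambda>a. \<psi> a - \<phi> a) \<in> coboundaries p X"
  moreover have "\<psi> = (\<lambda>a. (\<psi> a - \<phi> a) + \<phi> a)"
    by simp
  ultimately show "\<psi> \<in> cohomology_class p X \<phi>"
    unfolding cohomology_class_def r_coset_def cocycle_group_def
    by (auto intro!: bexI[of _ "\<lambda>a. \<psi> a - \<phi> a"])
qed

lemma cohomology_class_eq_iff:
  "cohomology_class (Suc p) X \<psi> = cohomology_class (Suc p) X \<phi> \<longleftrightarrow>
    (\<lambda>a. \<psi> a - \<phi> a) \<in> coboundaries (Suc p) X" (is "?L \<longleftrightarrow> ?R")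
proof
  assume ?L
  moreover have "\<psi> \<in> cohomology_class (Suc p) X \<psi>"
    by (simp add: cohomology_class_iff coboundaries_0)
  ultimately show ?R
    by (simp add: cohomology_class_iff)
next
  assume R: ?R
  show ?L
  proof (intro subset_antisym subsetI)
    fix \<theta> assume "\<theta> \<in> cohomology_class (Suc p) X \<psi>"
    then show "\<theta> \<in> cohomology_class (Suc p) X \<phi>"
      using coboundaries_combine(1)[OF _ R, of "\<lambda>a. \<theta> a - \<psi> a"] by (simp add: cohomology_class_iff)
  next
    fix \<theta> assume "\<theta> \<in> cohomology_class (Suc p) X \<phi>"
    then show "\<theta> \<in> cohomology_class (Suc p) X \<psi>"
      using coboundaries_combine(2)[OF _ R, of "\<lambda>a. \<theta> a - \<phi> a"] by (simp add: cohomology_class_iff)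
  qed
qed

lemma cohomology_group_cases:
  assumes "\<alpha> \<in> carrier (cohomology_group p X)"
  obtains \<phi> where "\<phi> \<in> cocycles p X" "\<alpha> = cohomology_class p X \<phi>"
  using assms by (auto simp: cohomology_group_def FactGroup_def RCOSETS_def cohomology_class_def cocycle_group_def)

lemma cochain_pullback_cochain:
  assumes "continuous_map X Y f" "\<phi> \<in> cochains p Y"
  shows "cochain_pullback p X f \<phi> \<in> cochains p X"
  using assms singular_chain_chain_map[OF _ assms(1)]
  unfolding cochains_def cochain_pullback_def by (auto simp: chain_map_add singular_chain_add)

lemma coboundary_cochain_pullback:
  assumes "continuous_map X Y f"
  shows "coboundary p X (cochain_pullback p X f \<phi>) = cochain_pullback (Suc p) X f (coboundary p Y \<phi>)"
  using singular_chain_chain_map[OF _ assms] singular_chain_boundary_alt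
  by (fastforce simp: coboundary_def cochain_pullback_def chain_boundary_chain_map)

lemma cochain_pullback_cocycle:
  assumes "continuous_map X Y f" "\<phi> \<in> cocycles p Y"
  shows "cochain_pullback p X f \<phi> \<in> cocycles p X"
  using assms cochain_pullback_cochain[OF assms(1), of \<phi> p] coboundary_cochain_pullback[OF assms(1), of p \<phi>]
  by (auto simp: cocycles_def cochain_pullback_def)

lemma path_value_pullback:
  assumes "pathin X g"
  shows "path_value (cochain_pullback 1 X f \<phi>) g = path_value \<phi> (\<lambda>t. f (g t))"
proof -
  have "simplex_map 1 f (path_simplex g) = path_simplex (\<lambda>t. f (g t))"
    unfolding simplex_map_def path_simplex_def by (auto intro!: restrict_ext)
  then show ?thesis
    using singular_simplex_path_simplex[OF assms]
    by (simp add: path_value_def cochain_pullback_def singular_chain_of)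
qed

lemma cohomology_pullback_class:
  assumes f: "continuous_map X Y f"
  shows "cohomology_pullback (Suc p) X f (cohomology_class (Suc p) Y \<phi>) =
    cohomology_class (Suc p) X (cochain_pullback (Suc p) X f \<phi>)"
proof -
  have "cohomology_class (Suc p) X (cochain_pullback (Suc p) X f \<psi>) =
      cohomology_class (Suc p) X (cochain_pullback (Suc p) X f \<phi>)"
    if \<psi>: "\<psi> \<in> cohomology_class (Suc p) Y \<phi>" for \<psi>
  proof -
    obtain \<kappa> where \<kappa>: "\<kappa> \<in> cochains p Y" "(\<lambda>a. \<psi> a - \<phi> a) = coboundary p Y \<kappa>"
      using \<psi> by (auto simp: cohomology_class_iff coboundaries_def)
    have "(\<lambda>a. cochain_pullback (Suc p) X f \<psi> a - cochain_pullback (Suc p) X f \<phi> a) =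
        cochain_pullback (Suc p) X f (\<lambda>a. \<psi> a - \<phi> a)"
      by (auto simp: cochain_pullback_def)
    also have "\<dots> = coboundary p X (cochain_pullback p X f \<kappa>)"
      using coboundary_cochain_pullback[OF f, of p \<kappa>] \<kappa>(2) by simp
    finally show ?thesis
      using cochain_pullback_cochain[OF f \<kappa>(1)] by (auto simp: cohomology_class_eq_iff coboundaries_def)
  qed
  moreover have "\<phi> \<in> cohomology_class (Suc p) Y \<phi>"
    by (simp add: cohomology_class_iff coboundaries_0)
  ultimately have "(\<lambda>\<psi>. cohomology_class (Suc p) X (cochain_pullback (Suc p) X f \<psi>)) ` cohomology_class (Suc p) Y \<phi> =
      {cohomology_class (Suc p) X (cochain_pullback (Suc p) X f \<phi>)}"
    by blast
  then show ?thesis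
    by (simp add: cohomology_pullback_def)
qed

proposition cohomology_pullback_fixes_iff:
  assumes f: "continuous_map X X f" and \<phi>: "\<phi> \<in> cocycles 1 X" and pc: "path_connected_space X"
  shows "cohomology_pullback 1 X f (cohomology_class 1 X \<phi>) = cohomology_class 1 X \<phi> \<longleftrightarrow>
    (\<forall>g. pathin X g \<longrightarrow> g 0 = g 1 \<longrightarrow> path_value \<phi> (\<lambda>t. f (g t)) = path_value \<phi> g)"
proof -
  let ?d = "\<lambda>a. cochain_pullback 1 X f \<phi> a - \<phi> a"
  have "cohomology_pullback 1 X f (cohomology_class 1 X \<phi>) = cohomology_class 1 X \<phi> \<longleftrightarrow> ?d \<in> coboundaries 1 X"
    using cohomology_pullback_class[OF f, of 0 \<phi>] cohomology_class_eq_iff[of 0 X _ \<phi>] by simp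
  also have "\<dots> \<longleftrightarrow> (\<forall>g. pathin X g \<longrightarrow> g 0 = g 1 \<longrightarrow> path_value ?d g = 0)"
    using cocycles_diff[OF cochain_pullback_cocycle[OF f \<phi>] \<phi>] pc by (rule cocycle_coboundary_iff)
  also have "\<dots> \<longleftrightarrow> (\<forall>g. pathin X g \<longrightarrow> g 0 = g 1 \<longrightarrow> path_value \<phi> (\<lambda>t. f (g t)) = path_value \<phi> g)"
    using path_value_pullback[of X _ f \<phi>] by (auto simp: path_value_def)
  finally show ?thesis .
qed

lemma loop_class_self: "g \<in> loops X x \<Longrightarrow> g \<in> loop_class X x g"
  by (simp add: loops_def loop_class_def pathin_def)

lemma loop_class_subset_loops: "loop_class X x g \<subseteq> loops X x"
  unfolding loop_class_def loops_def pathin_def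
  by (auto dest: homotopic_with_imp_property homotopic_with_imp_continuous_maps)

lemma holonomy_loop_class:
  assumes \<phi>: "\<phi> \<in> cocycles 1 X" and g: "g \<in> loops X x"
  shows "holonomy (cohomology_class 1 X \<phi>) (loop_class X x g) = path_value \<phi> g"
proof -
  have "path_value \<psi> h = path_value \<phi> g"
    if \<psi>: "\<psi> \<in> cohomology_class 1 X \<phi>" and hg: "h \<in> loop_class X x g" for \<psi> h
  proof -
    have h: "pathin X h" "h 0 = h 1"
      using hg loop_class_subset_loops[of X x g] by (auto simp: loops_def)
    obtain \<kappa> where "\<kappa> \<in> cochains 0 X" "(\<lambda>a. \<psi> a - \<phi> a) = coboundary 0 X \<kappa>"
      using \<psi> by (auto simp: cohomology_class_iff coboundaries_def)
    then have "path_value (\<lambda>a. \<psi> a - \<phi> a) h = 0"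
      using h by (simp add: path_value_coboundary)
    then have "path_value \<psi> h = path_value \<phi> h"
      by (simp add: path_value_def)
    then show ?thesis
      using hg path_value_homotopic[OF \<phi>, of x x g h] by (simp add: loop_class_def)
  qed
  moreover have "\<phi> \<in> cohomology_class 1 X \<phi>"
    using coboundaries_0[of 0 X] by (simp add: cohomology_class_iff)
  ultimately have "{path_value \<psi> h | \<psi> h. \<psi> \<in> cohomology_class 1 X \<phi> \<and> h \<in> loop_class X x g} =
      {path_value \<phi> g}"
    using loop_class_self[OF g] by blast
  then have "{\<psi> (frag_of (path_simplex h)) | \<psi> h. \<psi> \<in> cohomology_class 1 X \<phi> \<and> h \<in> loop_class X x g} =
      {path_value \<phi> g}"
    unfolding path_value_def .
  then show ?thesis
    unfolding holonomy_def by (simp only: the_elem_eq)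
qed


section \<open>Homeomorphism groups\<close>

lemma homeo_group_carrier:
  "f \<in> carrier (homeo_group X) \<longleftrightarrow> f \<in> extensional (topspace X) \<and> homeomorphic_map X X f"
proof -
  have "bij_betw f (topspace X) (topspace X)" if "homeomorphic_map X X f"
    using that homeomorphic_imp_injective_map homeomorphic_imp_surjective_map
    unfolding bij_betw_def by blast
  then show ?thesis
    by (auto simp: homeo_group_def Bij_def)
qed

lemma homeo_group_mult:
  assumes "f \<in> carrier (homeo_group X)" "g \<in> carrier (homeo_group X)"
  shows "f \<otimes>\<^bsub>homeo_group X\<^esub> g = compose (topspace X) f g"
  using assms by (simp add: homeo_group_def BijGroup_def)

lemma homeo_group_one: "\<one>\<^bsub>homeo_group X\<^esub> = (\<lambda>x\<in>topspace X. x)"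
  by (simp add: homeo_group_def BijGroup_def)

lemma restrict_in_homeo_group:
  assumes "homeomorphic_maps X X f f'"
  shows "restrict f (topspace X) \<in> carrier (homeo_group X)"
proof -
  have "homeomorphic_map X X f"
    using assms homeomorphic_map_maps by blast
  then have "homeomorphic_map X X (restrict f (topspace X))"
    by (rule homeomorphic_map_eq) simp
  then show ?thesis
    by (simp add: homeo_group_carrier)
qed

lemma homeo_group_maps:
  assumes "f \<in> carrier (homeo_group X)"
  obtains f' where "homeomorphic_maps X X f f'"
  using assms homeomorphic_map_maps unfolding homeo_group_carrier by blast

lemma homeo_group_mem: "f \<in> carrier (homeo_group X) \<Longrightarrow> x \<in> topspace X \<Longrightarrow> f x \<in> topspace X"
  using homeomorphic_imp_surjective_map unfolding homeo_group_carrier by blast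

lemma homeo_group_eqI:
  assumes "f \<in> carrier (homeo_group X)" "g \<in> carrier (homeo_group X)"
    and "\<And>x. x \<in> topspace X \<Longrightarrow> f x = g x"
  shows "f = g"
  using assms by (intro extensionalityI[of f "topspace X" g]) (auto simp: homeo_group_carrier)

lemma group_homeo_group: "group (homeo_group X)"
proof (rule groupI)
  fix f g assume fg: "f \<in> carrier (homeo_group X)" "g \<in> carrier (homeo_group X)"
  then have "homeomorphic_map X X (f \<circ> g)"
    by (auto simp: homeo_group_carrier intro: homeomorphic_map_compose)
  then have "homeomorphic_map X X (compose (topspace X) f g)"
    by (rule homeomorphic_map_eq) (simp add: compose_def)
  with fg show "f \<otimes>\<^bsub>homeo_group X\<^esub> g \<in> carrier (homeo_group X)"
    by (simp add: homeo_group_mult) (simp add: homeo_group_carrier)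
next
  show one: "\<one>\<^bsub>homeo_group X\<^esub> \<in> carrier (homeo_group X)"
    using restrict_in_homeo_group[of X id id] by (simp add: homeo_group_one id_def homeomorphic_maps_def)
  fix f assume f: "f \<in> carrier (homeo_group X)"
  show "\<one>\<^bsub>homeo_group X\<^esub> \<otimes>\<^bsub>homeo_group X\<^esub> f = f"
    using f homeo_group_mem[OF f]
    by (simp add: homeo_group_mult[OF one f])
      (auto simp: homeo_group_one compose_def homeo_group_carrier extensional_def)
  obtain f' where f': "homeomorphic_maps X X f f'"
    using f by (rule homeo_group_maps)
  let ?g = "restrict f' (topspace X)"
  have g: "?g \<in> carrier (homeo_group X)"
    using restrict_in_homeo_group[OF homeomorphic_maps_sym[THEN iffD1, OF f']] .
  moreover have "?g \<otimes>\<^bsub>homeo_group X\<^esub> f = \<one>\<^bsub>homeo_group X\<^esub>"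
    using f' homeo_group_mem[OF f]
    unfolding homeo_group_mult[OF g f] homeo_group_one compose_def homeomorphic_maps_def
    by (intro restrict_ext) simp
  ultimately show "\<exists>g\<in>carrier (homeo_group X). g \<otimes>\<^bsub>homeo_group X\<^esub> f = \<one>\<^bsub>homeo_group X\<^esub>"
    by blast
next
  fix f g h
  assume "f \<in> carrier (homeo_group X)" "g \<in> carrier (homeo_group X)" "h \<in> carrier (homeo_group X)"
  moreover from this have "f \<in> Bij (topspace X)" "g \<in> Bij (topspace X)" "h \<in> Bij (topspace X)"
    by (auto simp: homeo_group_def)
  moreover have "group (BijGroup (topspace X))"
    by (rule group_BijGroup)
  ultimately show "f \<otimes>\<^bsub>homeo_group X\<^esub> g \<otimes>\<^bsub>homeo_group X\<^esub> h =
      f \<otimes>\<^bsub>homeo_group X\<^esub> (g \<otimes>\<^bsub>homeo_group X\<^esub> h)"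
    using group.is_monoid[THEN monoid.m_assoc, of "BijGroup (topspace X)" f g h]
    by (simp add: homeo_group_def BijGroup_def)
qed

lemma homeo_group_continuous: "f \<in> carrier (homeo_group X) \<Longrightarrow> continuous_map X X f"
  unfolding homeo_group_carrier using homeomorphic_imp_continuous_map by blast

lemma homeo_group_inv_apply:
  assumes f: "f \<in> carrier (homeo_group X)" and x: "x \<in> topspace X"
  shows "f ((inv\<^bsub>homeo_group X\<^esub> f) x) = x" "(inv\<^bsub>homeo_group X\<^esub> f) (f x) = x"
proof -
  have i: "inv\<^bsub>homeo_group X\<^esub> f \<in> carrier (homeo_group X)"
    using group.inv_closed[OF group_homeo_group f] .
  show "f ((inv\<^bsub>homeo_group X\<^esub> f) x) = x"
    using fun_cong[OF group.r_inv[OF group_homeo_group f], of x] x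
    unfolding homeo_group_mult[OF f i] homeo_group_one by (simp add: compose_def)
  show "(inv\<^bsub>homeo_group X\<^esub> f) (f x) = x"
    using fun_cong[OF group.l_inv[OF group_homeo_group f], of x] x
    unfolding homeo_group_mult[OF i f] homeo_group_one by (simp add: compose_def)
qed


section \<open>The fundamental group acting on the universal covering\<close>

context
  fixes E :: "'e topology" and X :: "'a topology" and p :: "'e \<Rightarrow> 'a"
  assumes uc: "universal_covering E X p"
begin

lemma universal_covering_covering: "covering_map E X p"
  and universal_covering_simply_connected: "simply_connected_space E"
  using uc by (auto simp: universal_covering_def)

lemma universal_covering_continuous: "continuous_map E X p"
  and universal_covering_surj: "p ` topspace E = topspace X"
  using universal_covering_covering by (auto simp: covering_map_def)

lemma universal_covering_proj_mem: "e \<in> topspace E \<Longrightarrow> p e \<in> topspace X"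
  using universal_covering_surj by blast

lemma universal_covering_connected: "connected_space E"
  using universal_covering_simply_connected by (rule simply_connected_imp_connected)

lemma universal_covering_base_path_connected: "path_connected_space X"
  using path_connectedin_continuous_map_image[OF universal_covering_continuous, of "topspace E"]
    universal_covering_simply_connected universal_covering_surj
  by (simp add: simply_connected_space_def path_connectedin_topspace)

lemma deck_transformation_ex:
  assumes "e \<in> topspace E" "e' \<in> topspace E" "p e' = p e"
  obtains g where "g \<in> deck_transformations E p" "g e = e'"
proof -
  have "homeomorphic_maps X X id id"
    by (simp add: homeomorphic_maps_def)
  then have "\<exists>F F'. homeomorphic_maps E E F F' \<and> F e = e' \<and> (\<forall>d\<in>topspace E. p (F d) = id (p d))"
  proof (rule universal_covering_lift_homeomorphism[OF uc _ assms(1,2)])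
    show "p e' = id (p e)"
      using assms(3) by simp
  qed blast
  then obtain F F' where F: "homeomorphic_maps E E F F'" "F e = e'" "\<And>d. d \<in> topspace E \<Longrightarrow> p (F d) = p d"
    by auto
  have "restrict F (topspace E) \<in> deck_transformations E p"
    using F restrict_in_homeo_group[OF F(1)] by (simp add: deck_transformations_def)
  then show ?thesis
    using that F(2) assms(1) by (metis restrict_apply')
qed

lemma deck_transformation_homeo: "g \<in> deck_transformations E p \<Longrightarrow> g \<in> carrier (homeo_group E)"
  and deck_transformation_proj: "g \<in> deck_transformations E p \<Longrightarrow> e \<in> topspace E \<Longrightarrow> p (g e) = p e"
  by (auto simp: deck_transformations_def)

lemma deck_transformation_continuous: "g \<in> deck_transformations E p \<Longrightarrow> continuous_map E E g"
  using deck_transformation_homeo homeomorphic_imp_continuous_map unfolding homeo_group_carrier by blast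

lemma deck_transformation_unique:
  assumes "g \<in> deck_transformations E p" "g' \<in> deck_transformations E p"
    and "e \<in> topspace E" "g e = g' e"
  shows "g = g'"
proof (rule homeo_group_eqI)
  fix d assume "d \<in> topspace E"
  then show "g d = g' d"
    using assms covering_map_unique_lift[OF universal_covering_covering universal_covering_connected
        deck_transformation_continuous[OF assms(1)] deck_transformation_continuous[OF assms(2)], of e d]
    by (simp add: deck_transformation_proj)
qed (use assms deck_transformation_homeo in auto)

lemma lift_endpoint_eq:
  assumes "pathin E d" "\<And>t. t \<in> {0..1} \<Longrightarrow> p (d t) = g t"
  shows "lift_endpoint E p (d 0) g = d 1"
  unfolding lift_endpoint_def
proof (rule the_equality)
  show "\<exists>\<delta>. pathin E \<delta> \<and> \<delta> 0 = d 0 \<and> \<delta> 1 = d 1 \<and> (\<forall>t\<in>{0..1}. p (\<delta> t) = g t)"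
    using assms by blast
  fix e assume "\<exists>\<delta>. pathin E \<delta> \<and> \<delta> 0 = d 0 \<and> \<delta> 1 = e \<and> (\<forall>t\<in>{0..1}. p (\<delta> t) = g t)"
  then obtain \<delta> where "pathin E \<delta>" "\<delta> 0 = d 0" "\<delta> 1 = e" "\<And>t. t \<in> {0..1} \<Longrightarrow> p (\<delta> t) = g t"
    by blast
  then show "e = d 1"
    using covering_map_path_lift_unique[OF universal_covering_covering, of \<delta> d 1] assms by simp
qed

text \<open>Lifts of homotopic loops end at the same point by monodromy, and a deck transformation is
  determined by the image of one point, so the description in \<^const>\<open>deck_action\<close> is satisfied by
  exactly one transformation.\<close>

lemma deck_action_loop_class:
  assumes d: "pathin E d" "\<And>t. t \<in> {0..1} \<Longrightarrow> p (d t) = \<gamma> t" and \<gamma>: "\<gamma> \<in> loops X x"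
    and g: "g \<in> deck_transformations E p" "g (d 0) = d 1"
  shows "deck_action E p (d 0) (loop_class X x \<gamma>) = g"
  unfolding deck_action_def
proof (rule the_equality)
  have d0: "d 0 \<in> topspace E"
    using pathin_image[OF d(1)] by simp
  show "g \<in> deck_transformations E p \<and> (\<forall>\<gamma>'\<in>loop_class X x \<gamma>. g (d 0) = lift_endpoint E p (d 0) \<gamma>')"
  proof (intro conjI ballI g(1))
    fix \<gamma>' assume \<gamma>': "\<gamma>' \<in> loop_class X x \<gamma>"
    then have "pathin X \<gamma>'" "\<gamma>' 0 = p (d 0)"
      using loop_class_subset_loops[of X x \<gamma>] \<gamma> d(2)[of 0] by (auto simp: loops_def)
    then obtain d' where d': "pathin E d'" "d' 0 = d 0" "\<And>t. t \<in> {0..1} \<Longrightarrow> p (d' t) = \<gamma>' t"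
      using covering_map_path_lift[OF universal_covering_covering _ d0, of \<gamma>'] by metis
    have "d 1 = d' 1"
      using covering_map_monodromy[OF universal_covering_covering, of x x \<gamma> \<gamma>' d d'] \<gamma>' d d'
      by (simp add: loop_class_def)
    then show "g (d 0) = lift_endpoint E p (d 0) \<gamma>'"
      using lift_endpoint_eq[OF d'(1,3)] d'(2) g(2) by simp
  qed
  fix g' assume "g' \<in> deck_transformations E p \<and> (\<forall>\<gamma>'\<in>loop_class X x \<gamma>. g' (d 0) = lift_endpoint E p (d 0) \<gamma>')"
  then have "g' \<in> deck_transformations E p" "g' (d 0) = d 1"
    using loop_class_self[OF \<gamma>] lift_endpoint_eq[OF d] by auto
  then show "g' = g"
    using g deck_transformation_unique d0 by simp
qed

text \<open>Loops in \<open>E\<close> are contractible, so the pullback of \<open>\<phi>\<close> to \<open>E\<close> vanishes on them.\<close>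

lemma path_value_lift_primitive:
  assumes \<phi>: "\<phi> \<in> cocycles 1 X"
  obtains h where "\<And>g. pathin E g \<Longrightarrow> path_value \<phi> (\<lambda>t. p (g t)) = h (g 1) - h (g 0)"
proof -
  let ?\<psi> = "cochain_pullback 1 E p \<phi>"
  have \<psi>: "?\<psi> \<in> cocycles 1 E"
    using universal_covering_continuous \<phi> by (rule cochain_pullback_cocycle)
  have "path_value ?\<psi> g = 0" if g: "pathin E g" "g 0 = g 1" for g
    using path_value_homotopic[OF \<psi> simply_connected_loop_contractible[OF universal_covering_simply_connected g(1) g(2) refl]]
      path_value_const[OF \<psi> pathin_image[OF g(1), of 1]] by simp
  then obtain h where "\<And>g. pathin E g \<Longrightarrow> path_value ?\<psi> g = h (g 1) - h (g 0)"
    using cocycle_primitive[OF \<psi>] universal_covering_simply_connected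
    unfolding simply_connected_space_def by metis
  then show ?thesis
    using that path_value_pullback[of E _ p \<phi>] by metis
qed

end


section \<open>The foliated circle bundle\<close>

text \<open>The primitive \<open>h\<close> of the pulled back cocycle is carried along as a parameter: it is the function
  by which the bundle is untwisted over \<open>E\<close>, and it is unique only up to a constant.\<close>

locale flat_circle_bundle =
  fixes X :: "'a topology" and E :: "'e topology" and p :: "'e \<Rightarrow> 'a" and e\<^sub>0 :: 'e
    and \<phi> :: "'a chain \<Rightarrow> circle" and h :: "'e \<Rightarrow> circle"
  assumes uc: "universal_covering E X p" and e0: "e\<^sub>0 \<in> topspace E" and cocycle: "\<phi> \<in> cocycles 1 X"
    and primitive: "pathin E g \<Longrightarrow> path_value \<phi> (\<lambda>t. p (g t)) = h (g 1) - h (g 0)"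
begin

definition \<rho> :: "('a chain \<Rightarrow> circle) set"
  where "\<rho> = cohomology_class 1 X \<phi>"

lemmas cov = universal_covering_covering[OF uc]
  and sc = universal_covering_simply_connected[OF uc]
  and proj_mem = universal_covering_proj_mem[OF uc]

lemma connect:
  assumes "e \<in> topspace E" "e' \<in> topspace E"
  obtains a where "pathin E a" "a 0 = e" "a 1 = e'"
  using simply_connected_path[OF sc assms] .

text \<open>A path and its image under a deck transformation lie over the same path in \<open>X\<close>, so \<open>h\<close> changes
  equally along both.\<close>

lemma deck_primitive:
  assumes g: "g \<in> deck_transformations E p" and e: "e \<in> topspace E" "e' \<in> topspace E"
  shows "h (g e) - h e = h (g e') - h e'"
proof -
  obtain a where a: "pathin E a" "a 0 = e" "a 1 = e'"
    using connect[OF e] .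
  have "path_value \<phi> (\<lambda>t. p (g (a t))) = path_value \<phi> (\<lambda>t. p (a t))"
    using deck_transformation_proj[OF uc g] pathin_image[OF a(1)] by (intro path_value_cong) simp
  then have "h (g e') - h (g e) = h e' - h e"
    using primitive[OF a(1)] primitive[OF pathin_o[OF a(1) deck_transformation_continuous[OF uc g]]] a(2,3)
    by simp
  then show ?thesis
    by (simp add: algebra_simps)
qed

text \<open>The common value of \<open>h (g e) - h e\<close> is the holonomy of the loop class that acts by \<open>g\<close>; this
  eliminates the fundamental group from the description of the bundle.\<close>

proposition bundle_rel_iff:
  "((e, z), (e', z')) \<in> bundle_rel E X p e\<^sub>0 \<rho> \<longleftrightarrow>
    e \<in> topspace E \<and> e' \<in> topspace E \<and> p e = p e' \<and> z - h e = z' - h e'" (is "?L \<longleftrightarrow> ?R")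
proof
  assume ?L
  then obtain C where C: "e \<in> topspace E" "C \<in> carrier (fundamental_group X (p e\<^sub>0))"
    and e': "e' = deck_action E p e\<^sub>0 C e" "z' = holonomy \<rho> C + z"
    unfolding bundle_rel_def by auto
  obtain \<gamma> where \<gamma>: "\<gamma> \<in> loops X (p e\<^sub>0)" "C = loop_class X (p e\<^sub>0) \<gamma>"
    using C(2) by (auto simp: fundamental_group_def)
  then have "pathin X \<gamma>" "\<gamma> 0 = p e\<^sub>0" "\<gamma> 1 = p e\<^sub>0"
    by (auto simp: loops_def)
  then obtain d where d: "pathin E d" "d 0 = e\<^sub>0" "\<And>t. t \<in> {0..1} \<Longrightarrow> p (d t) = \<gamma> t"
    using covering_map_path_lift[OF cov _ e0] by metis
  have "d 1 \<in> topspace E" "p (d 1) = p e\<^sub>0"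
    using pathin_image[OF d(1)] d(3)[of 1] \<open>\<gamma> 1 = p e\<^sub>0\<close> by auto
  then obtain g where g: "g \<in> deck_transformations E p" "g e\<^sub>0 = d 1"
    using deck_transformation_ex[OF uc e0] by metis
  have "deck_action E p e\<^sub>0 C = g"
    using deck_action_loop_class[OF uc d(1,3) \<gamma>(1) g(1)] d(2) g(2) \<gamma>(2) by simp
  moreover have "holonomy \<rho> C = h (d 1) - h e\<^sub>0"
    using holonomy_loop_class[OF cocycle \<gamma>(1)] path_value_cong[of "\<lambda>t. p (d t)" \<gamma> \<phi>] d primitive[OF d(1)] \<gamma>(2)
    by (simp add: \<rho>_def)
  then have "holonomy \<rho> C = h (g e) - h e"
    using deck_primitive[OF g(1) C(1) e0] g(2) by simp
  ultimately show ?R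
    using deck_transformation_proj[OF uc g(1) C(1)]
      homeo_group_mem[OF deck_transformation_homeo[OF uc g(1)] C(1)] C(1) e' g(2)
    by (simp add: algebra_simps)
next
  assume R: ?R
  then obtain g where g: "g \<in> deck_transformations E p" "g e = e'"
    using deck_transformation_ex[OF uc] by metis
  have ge0: "g e\<^sub>0 \<in> topspace E"
    using homeo_group_mem[OF deck_transformation_homeo[OF uc g(1)] e0] .
  obtain d where d: "pathin E d" "d 0 = e\<^sub>0" "d 1 = g e\<^sub>0"
    using connect[OF e0 ge0] .
  let ?\<gamma> = "\<lambda>t. p (d t)" and ?C = "loop_class X (p e\<^sub>0) (\<lambda>t. p (d t))"
  have \<gamma>: "?\<gamma> \<in> loops X (p e\<^sub>0)"
    using pathin_o[OF d(1) universal_covering_continuous[OF uc]] d deck_transformation_proj[OF uc g(1) e0]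
    by (simp add: loops_def)
  have "holonomy \<rho> ?C = h e' - h e"
    using holonomy_loop_class[OF cocycle \<gamma>] primitive[OF d(1)] d deck_primitive[OF g(1) _ e0, of e] g(2) R
    by (simp add: \<rho>_def)
  moreover have "z' = (h e' - h e) + z"
    using R by (simp add: algebra_simps)
  ultimately have "holonomy \<rho> ?C + z = z'"
    by simp
  moreover have "deck_action E p e\<^sub>0 ?C e = e'"
    using deck_action_loop_class[OF uc d(1) refl \<gamma> g(1)] d g(2) by simp
  moreover have "?C \<in> carrier (fundamental_group X (p e\<^sub>0))"
    using \<gamma> by (simp add: fundamental_group_def)
  ultimately show ?L
    using R unfolding bundle_rel_def by blast
qed

text \<open>The orbit of \<open>(e, z)\<close>, in the form provided by the previous proposition.\<close>

definition point :: "'e \<Rightarrow> circle \<Rightarrow> ('e \<times> circle) set"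
  where "point e z = {(e', z'). e' \<in> topspace E \<and> p e = p e' \<and> z - h e = z' - h e'}"

lemma point_eq_iff:
  assumes "e \<in> topspace E" "e' \<in> topspace E"
  shows "point e z = point e' z' \<longleftrightarrow> p e = p e' \<and> z - h e = z' - h e'"
proof
  assume "point e z = point e' z'"
  moreover have "(e, z) \<in> point e z"
    using assms by (simp add: point_def)
  ultimately have "(e, z) \<in> point e' z'"
    by simp
  then show "p e = p e' \<and> z - h e = z' - h e'"
    by (simp add: point_def)
qed (auto simp: point_def)

lemma point_self: "e \<in> topspace E \<Longrightarrow> (e, z) \<in> point e z"
  by (simp add: point_def)

lemma mem_point: "(e', z') \<in> point e z \<Longrightarrow> e \<in> topspace E \<Longrightarrow> e' \<in> topspace E \<and> point e' z' = point e z"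
  using point_eq_iff[of e' e z' z] by (auto simp: point_def)

abbreviation total :: "('e \<times> circle) set topology"
  where "total \<equiv> bundle_space E X p e\<^sub>0 \<rho>"

definition points :: "('e \<times> circle) set set"
  where "points = {point e z | e z. e \<in> topspace E}"

lemma points_quotient: "(topspace E \<times> UNIV) // bundle_rel E X p e\<^sub>0 \<rho> = points"
proof -
  have "bundle_rel E X p e\<^sub>0 \<rho> `` {(e, z)} = point e z" if "e \<in> topspace E" for e z
    using that by (auto simp: point_def bundle_rel_iff)
  then show ?thesis
    unfolding quotient_def points_def by fastforce
qed

lemma points_disjoint:
  assumes "u \<in> points" "v \<in> points" "x \<in> u" "x \<in> v"
  shows "u = v"
proof -
  obtain e z where x: "x = (e, z)" by (cases x)
  have "w = point e z" if "w \<in> points" "x \<in> w" for w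
    using that mem_point[of e z] unfolding points_def x by blast
  then show ?thesis
    using assms by metis
qed

lemma Union_points: "\<Union>points = topspace E \<times> UNIV"
proof
  show "\<Union>points \<subseteq> topspace E \<times> UNIV"
    by (auto simp: points_def point_def)
  show "topspace E \<times> UNIV \<subseteq> \<Union>points"
  proof
    fix q :: "'e \<times> circle" assume "q \<in> topspace E \<times> UNIV"
    then have "fst q \<in> topspace E" "q \<in> point (fst q) (snd q)"
      by (auto simp: point_def)
    then show "q \<in> \<Union>points"
      unfolding points_def by blast
  qed
qed

lemma Union_points_preimage:
  assumes "U \<subseteq> points"
  shows "\<Union>U = {q \<in> topspace E \<times> UNIV. point (fst q) (snd q) \<in> U}"
proof (intro subset_antisym subsetI)
  fix q assume "q \<in> \<Union>U"
  then obtain u where u: "u \<in> U" "q \<in> u" by blast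
  then obtain e z where ez: "u = point e z" "e \<in> topspace E"
    using assms unfolding points_def by blast
  then show "q \<in> {q \<in> topspace E \<times> UNIV. point (fst q) (snd q) \<in> U}"
    using mem_point[of "fst q" "snd q" e z] u by (cases q) auto
next
  fix q assume "q \<in> {q \<in> topspace E \<times> UNIV. point (fst q) (snd q) \<in> U}"
  then show "q \<in> \<Union>U"
    using point_self[of "fst q" "snd q"] by (cases q) auto
qed

abbreviation cylinder :: "('e \<times> circle) topology"
  where "cylinder \<equiv> prod_topology E (discrete_topology UNIV)"

lemma openin_total: "openin total U \<longleftrightarrow> U \<subseteq> points \<and> openin cylinder (\<Union>U)"
proof -
  have "istopology (\<lambda>U. U \<subseteq> points \<and> openin cylinder (\<Union>U))"
    unfolding istopology_def
  proof (intro conjI allI impI)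
    fix U V assume UV: "U \<subseteq> points \<and> openin cylinder (\<Union>U)" "V \<subseteq> points \<and> openin cylinder (\<Union>V)"
    have "\<Union>(U \<inter> V) = \<Union>U \<inter> \<Union>V"
      using UV points_disjoint by blast
    then show "openin cylinder (\<Union>(U \<inter> V))"
      using UV by (simp add: openin_Int)
    show "U \<inter> V \<subseteq> points"
      using UV by blast
  next
    fix \<K> assume K: "\<forall>K\<in>\<K>. K \<subseteq> points \<and> openin cylinder (\<Union>K)"
    then have "openin cylinder (\<Union>(Union ` \<K>))"
      by (intro openin_Union) auto
    moreover have "\<Union>(\<Union>\<K>) = \<Union>(Union ` \<K>)"
      by blast
    ultimately show "openin cylinder (\<Union>(\<Union>\<K>))"
      by simp
    show "\<Union>\<K> \<subseteq> points"
      using K by blast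
  qed
  then show ?thesis
    unfolding bundle_space_def points_quotient by (simp add: topology_inverse')
qed

lemma topspace_total: "topspace total = points"
proof -
  have "openin total points"
    by (simp add: openin_total Union_points openin_prod_Times_iff)
  moreover have "topspace total \<subseteq> points"
    using openin_total[of "topspace total"] by simp
  ultimately show ?thesis
    using openin_subset by blast
qed

lemma point_mem: "e \<in> topspace E \<Longrightarrow> point e z \<in> topspace total"
  unfolding topspace_total points_def by blast

lemma total_cases:
  assumes "u \<in> topspace total"
  obtains e z where "e \<in> topspace E" "u = point e z"
  using assms unfolding topspace_total points_def by blast

lemma quotient_map_point: "quotient_map cylinder total (\<lambda>q. point (fst q) (snd q))"
  unfolding quotient_map_def
proof (intro conjI allI impI)
  show "(\<lambda>q. point (fst q) (snd q)) ` topspace cylinder = topspace total"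
    unfolding topspace_total points_def by force
  fix U assume "U \<subseteq> topspace total"
  then show "openin cylinder {q \<in> topspace cylinder. point (fst q) (snd q) \<in> U} = openin total U"
    using Union_points_preimage[of U] by (simp add: openin_total topspace_total)
qed

text \<open>The saturation of \<open>V \<times> {s}\<close> is a union of translates of \<open>V\<close> under deck transformations, each at a
  constant height in the discrete circle. These sets are pieces of leaves of the foliation.\<close>

lemma openin_leaf:
  assumes V: "openin E V"
  shows "openin total {point e s | e. e \<in> V}"
proof -
  have VE: "V \<subseteq> topspace E"
    using openin_subset[OF V] .
  let ?U = "{point e s | e. e \<in> V}"
  have "openin cylinder (\<Union>?U)"
  proof (subst openin_subopen, intro ballI)
    fix q assume "q \<in> \<Union>?U"
    then obtain e where e: "e \<in> V" "q \<in> point e s" by blast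
    obtain e' z' where q: "q = (e', z')" by (cases q)
    have e': "e' \<in> topspace E" "p e = p e'" "s - h e = z' - h e'"
      using e q by (auto simp: point_def)
    obtain g where g: "g \<in> deck_transformations E p" "g e' = e"
      using deck_transformation_ex[OF uc e'(1) _ e'(2)] e(1) VE by blast
    let ?W = "{d \<in> topspace E. g d \<in> V}"
    have "openin E ?W"
      using deck_transformation_continuous[OF uc g(1)] V by (rule openin_continuous_map_preimage)
    then have "openin cylinder (?W \<times> {z'})"
      by (simp add: openin_prod_Times_iff)
    moreover have "q \<in> ?W \<times> {z'}"
      using q e e' g by simp
    moreover have "?W \<times> {z'} \<subseteq> \<Union>?U"
    proof
      fix r assume "r \<in> ?W \<times> {z'}"
      then obtain d where d: "r = (d, z')" "d \<in> topspace E" "g d \<in> V" by auto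
      have "z' = s - (h (g e') - h e')"
        using e'(3) g(2) by (simp add: algebra_simps)
      also have "\<dots> = s - (h (g d) - h d)"
        using deck_primitive[OF g(1) d(2) e'(1)] by simp
      finally have "(d, z') \<in> point (g d) s"
        using d deck_transformation_proj[OF uc g(1) d(2)] by (simp add: point_def)
      then show "r \<in> \<Union>?U"
        using d by blast
    qed
    ultimately show "\<exists>T. openin cylinder T \<and> q \<in> T \<and> T \<subseteq> \<Union>?U"
      by blast
  qed
  then show ?thesis
    using VE by (auto simp: openin_total points_def)
qed

lemma circle_action_point: "circle_action (point e z) s = point e (z + s)"
proof (intro subset_antisym subsetI)
  fix q assume "q \<in> circle_action (point e z) s"
  then show "q \<in> point e (z + s)"
    by (auto simp: circle_action_def point_def algebra_simps)
next
  fix q assume q: "q \<in> point e (z + s)"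
  obtain d w where dw: "q = (d, w)" by (cases q)
  then have "(d, w - s) \<in> point e z"
    using q by (simp add: point_def algebra_simps)
  then show "q \<in> circle_action (point e z) s"
    unfolding circle_action_def using dw by (auto intro!: image_eqI[of _ _ "(d, w - s)"])
qed

lemma bundle_proj_point:
  assumes "e \<in> topspace E"
  shows "bundle_proj p (point e z) = p e"
proof -
  have "(p \<circ> fst) ` point e z = {p e}"
    using point_self[OF assms, of z] by (force simp: point_def)
  then show ?thesis
    by (simp add: bundle_proj_def)
qed


section \<open>Automorphisms of the bundle and lifts of homeomorphisms\<close>

abbreviation "Aut \<equiv> bundle_aut_group E X p e\<^sub>0 \<rho>"

definition covers :: "(('e \<times> circle) set \<Rightarrow> ('e \<times> circle) set) \<Rightarrow> ('a \<Rightarrow> 'a) \<Rightarrow> bool"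
  where "covers F f \<longleftrightarrow> f \<in> carrier (homeo_group X) \<and>
    (\<forall>u\<in>topspace total. bundle_proj p (F u) = f (bundle_proj p u))"

lemma Aut_iff:
  "F \<in> carrier Aut \<longleftrightarrow> F \<in> carrier (homeo_group total) \<and>
    (\<forall>u\<in>topspace total. \<forall>s. F (circle_action u s) = circle_action (F u) s) \<and> (\<exists>f. covers F f)"
  unfolding bundle_aut_group_def covers_def Let_def by auto

lemma covers_unique: "covers F f \<Longrightarrow> covers F f' \<Longrightarrow> f = f'"
proof (rule homeo_group_eqI[of _ X])
  assume cov: "covers F f" "covers F f'"
  show "f \<in> carrier (homeo_group X)" "f' \<in> carrier (homeo_group X)"
    using cov by (auto simp: covers_def)
  fix x assume "x \<in> topspace X"
  then obtain e where "e \<in> topspace E" "x = p e"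
    using universal_covering_surj[OF uc] by blast
  then show "f x = f' x"
    using cov point_mem[of e 0] bundle_proj_point[of e 0] unfolding covers_def by metis
qed

lemma base_map_eq: "covers F f \<Longrightarrow> base_map E X p e\<^sub>0 \<rho> F = f"
  unfolding base_map_def using covers_unique[of F]
  by (intro the_equality) (auto simp: covers_def)

text \<open>The condition under which \<open>(e, z) \<mapsto> (F e, z + s)\<close> respects the identification of points.\<close>

definition fibre_compatible :: "('e \<Rightarrow> 'e) \<Rightarrow> bool"
  where "fibre_compatible F \<longleftrightarrow>
    (\<forall>e\<in>topspace E. \<forall>e'\<in>topspace E. p e = p e' \<longrightarrow> h (F e) - h e = h (F e') - h e')"

lemma fibre_compatibleD:
  "\<lbrakk>fibre_compatible F; e \<in> topspace E; e' \<in> topspace E; p e = p e'\<rbrakk> \<Longrightarrow> h (F e) - h e = h (F e') - h e'"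
  unfolding fibre_compatible_def by blast

definition bundle_map :: "('e \<Rightarrow> 'e) \<Rightarrow> circle \<Rightarrow> ('e \<times> circle) set \<Rightarrow> ('e \<times> circle) set"
  where "bundle_map F s = (\<lambda>u\<in>topspace total. the_elem ((\<lambda>(e, z). point (F e) (z + s)) ` u))"

lemma bundle_map_point:
  assumes F: "fibre_compatible F" "continuous_map E E F" "\<And>e. e \<in> topspace E \<Longrightarrow> p (F e) = f (p e)"
    and e: "e \<in> topspace E"
  shows "bundle_map F s (point e z) = point (F e) (z + s)"
proof -
  have "point (F e') (z' + s) = point (F e) (z + s)" if "(e', z') \<in> point e z" for e' z'
  proof -
    have e': "e' \<in> topspace E" "p e = p e'" "z - h e = z' - h e'"
      using that by (auto simp: point_def)
    then have "h (F e) - h e = h (F e') - h e'"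
      using fibre_compatibleD[OF F(1) e] by blast
    then have "h e - h e' = h (F e) - h (F e')"
      by (simp add: algebra_simps)
    moreover have "z' = z - (h e - h e')"
      using e'(3) by (simp add: algebra_simps)
    ultimately have "z' = z - (h (F e) - h (F e'))"
      by simp
    then have "z' + s - h (F e') = z + s - h (F e)"
      by (simp add: algebra_simps)
    moreover have "p (F e') = p (F e)"
      using F(3)[OF e] F(3)[OF e'(1)] e'(2) by simp
    ultimately show ?thesis
      using e e'(1) continuous_map_mem[OF F(2)] by (simp only: point_eq_iff)
  qed
  then have "(\<lambda>(e, z). point (F e) (z + s)) ` point e z \<subseteq> {point (F e) (z + s)}"
    by auto
  moreover have "point (F e) (z + s) \<in> (\<lambda>(e, z). point (F e) (z + s)) ` point e z"
    using point_self[OF e, of z] by (intro image_eqI[of _ _ "(e, z)"]) simp_all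
  ultimately have "(\<lambda>(e, z). point (F e) (z + s)) ` point e z = {point (F e) (z + s)}"
    by blast
  then show ?thesis
    by (simp add: bundle_map_def point_mem[OF e])
qed

text \<open>The lift of the inverse homeomorphism, with the opposite translation, induces the inverse map.
  Continuity is inherited from the product through the quotient map.\<close>

lemma bundle_map_Aut:
  assumes f: "f \<in> carrier (homeo_group X)" and F: "homeomorphic_maps E E F F'" "fibre_compatible F"
    and pF: "\<And>e. e \<in> topspace E \<Longrightarrow> p (F e) = f (p e)"
  shows "bundle_map F s \<in> carrier Aut" "covers (bundle_map F s) f"
proof -
  obtain f' where f': "homeomorphic_maps X X f f'"
    using f by (rule homeo_group_maps)
  have FE: "continuous_map E E F" "continuous_map E E F'" "\<And>e. e \<in> topspace E \<Longrightarrow> F' (F e) = e"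
    "\<And>e. e \<in> topspace E \<Longrightarrow> F (F' e) = e"
    using F(1) by (auto simp: homeomorphic_maps_def)
  note mem = continuous_map_mem[OF FE(1)] continuous_map_mem[OF FE(2)]
  have pF': "p (F' e) = f' (p e)" if "e \<in> topspace E" for e
    using pF[OF mem(2)[OF that]] FE(4)[OF that] f' proj_mem[OF mem(2)[OF that]]
    by (simp add: homeomorphic_maps_def)
  have F': "fibre_compatible F'"
    unfolding fibre_compatible_def
  proof (intro ballI impI)
    fix e e' assume e: "e \<in> topspace E" "e' \<in> topspace E" "p e = p e'"
    then have "h (F (F' e)) - h (F' e) = h (F (F' e')) - h (F' e')"
      using mem(2) pF' by (intro fibre_compatibleD[OF F(2)]) simp_all
    then show "h (F' e) - h e = h (F' e') - h e'"
      using e FE(4) by (simp add: algebra_simps)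
  qed
  note F_pt = bundle_map_point[OF F(2) FE(1) pF] and F'_pt = bundle_map_point[OF F' FE(2) pF']
  have continuous: "continuous_map total total (bundle_map G t)"
    if "continuous_map E E G" "\<And>e z. e \<in> topspace E \<Longrightarrow> bundle_map G t (point e z) = point (G e) (z + t)"
    for G t
  proof -
    have "continuous_map cylinder (discrete_topology UNIV) (\<lambda>q. snd q + t)"
      using continuous_map_compose[OF continuous_map_snd, of "discrete_topology UNIV" "discrete_topology UNIV" "\<lambda>z. z + t" E]
      by (simp add: o_def)
    moreover have "continuous_map cylinder E (\<lambda>q. G (fst q))"
      using continuous_map_compose[OF continuous_map_fst that(1)] by (simp add: o_def)
    ultimately have "continuous_map cylinder cylinder (\<lambda>q. (G (fst q), snd q + t))"
      by (simp add: continuous_map_pairwise o_def)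
    then have "continuous_map cylinder total ((\<lambda>q. point (fst q) (snd q)) \<circ> (\<lambda>q. (G (fst q), snd q + t)))"
      by (rule continuous_map_compose[OF _ quotient_imp_continuous_map[OF quotient_map_point]])
    then have "continuous_map cylinder total (\<lambda>q. point (G (fst q)) (snd q + t))"
      by (simp add: o_def)
    then have "continuous_map cylinder total (bundle_map G t \<circ> (\<lambda>q. point (fst q) (snd q)))"
      by (rule continuous_map_eq) (auto simp: that(2))
    then show ?thesis
      using quotient_map_point continuous_compose_quotient_map by blast
  qed
  have inverse: "homeomorphic_maps total total (bundle_map F s) (bundle_map F' (- s))"
    unfolding homeomorphic_maps_def
  proof (intro conjI ballI)
    show "continuous_map total total (bundle_map F s)" "continuous_map total total (bundle_map F' (- s))"
      using continuous F_pt F'_pt FE by auto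
    fix u assume "u \<in> topspace total"
    then obtain e z where "e \<in> topspace E" "u = point e z"
      by (rule total_cases)
    then show "bundle_map F' (- s) (bundle_map F s u) = u" "bundle_map F s (bundle_map F' (- s) u) = u"
      using F_pt F'_pt mem FE(3,4) by auto
  qed
  have "restrict (bundle_map F s) (topspace total) = bundle_map F s"
    by (simp add: bundle_map_def)
  then have homeo: "bundle_map F s \<in> carrier (homeo_group total)"
    using restrict_in_homeo_group[OF inverse] by simp
  show cv: "covers (bundle_map F s) f"
    unfolding covers_def
  proof (intro conjI ballI f)
    fix u assume "u \<in> topspace total"
    then obtain e z where "e \<in> topspace E" "u = point e z"
      by (rule total_cases)
    then show "bundle_proj p (bundle_map F s u) = f (bundle_proj p u)"
      using F_pt mem pF by (simp add: bundle_proj_point)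
  qed
  have "bundle_map F s (circle_action u t) = circle_action (bundle_map F s u) t"
    if u: "u \<in> topspace total" for u t
  proof -
    obtain e z where "e \<in> topspace E" "u = point e z"
      using total_cases[OF u] by blast
    then show ?thesis
      using F_pt by (simp add: circle_action_point algebra_simps)
  qed
  then show "bundle_map F s \<in> carrier Aut"
    using homeo cv by (auto simp: Aut_iff)
qed

text \<open>Any lift \<open>F\<close> of \<open>f\<close> will do; changing it by a deck transformation changes \<open>s\<close> by the holonomy.\<close>

proposition Aut_eq_bundle_map:
  assumes A: "A \<in> carrier Aut" and f: "covers A f"
    and F: "continuous_map E E F" and pF: "\<And>e. e \<in> topspace E \<Longrightarrow> p (F e) = f (p e)"
  obtains s where "fibre_compatible F" "A = bundle_map F s"
proof -
  have AC: "continuous_map total total A" and Aext: "A \<in> extensional (topspace total)"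
    using A homeomorphic_imp_continuous_map by (auto simp: Aut_iff homeo_group_carrier)
  have equiv: "A (circle_action u s) = circle_action (A u) s" if "u \<in> topspace total" for u s
    using A that by (simp add: Aut_iff)
  note FE = continuous_map_mem[OF F]
  have "\<exists>s. A (point e 0) = point (F e) s" if e: "e \<in> topspace E" for e
  proof -
    obtain d w where d: "d \<in> topspace E" "A (point e 0) = point d w"
      using continuous_map_mem[OF AC point_mem[OF e]] by (rule total_cases)
    have "p d = p (F e)"
      using f point_mem[OF e, of 0] d e pF by (auto simp: covers_def bundle_proj_point)
    then have "point d w = point (F e) (w - h d + h (F e))"
      using d FE[OF e] by (simp add: point_eq_iff)
    then show ?thesis
      using d by auto
  qed
  then obtain b where b: "\<And>e. e \<in> topspace E \<Longrightarrow> A (point e 0) = point (F e) (b e)"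
    by metis
  \<comment> \<open>The circle carries the discrete topology, so \<open>A\<close> maps leaves to leaves and \<open>b\<close> is locally
    constant.\<close>
  have "b e = b e\<^sub>0" if e: "e \<in> topspace E" for e
  proof (rule connected_space_locally_constant[OF universal_covering_connected[OF uc] _ e e0])
    fix d assume d: "d \<in> topspace E"
    obtain T u \<sigma> where u: "F d \<in> u" and sh: "sheet E X p T u \<sigma>"
      by (metis covering_map_sheet_at[OF cov FE[OF d]])
    have uE: "openin E u" "u \<subseteq> topspace E"
      using sh openin_subset by (auto simp: sheet_def)
    have "continuous_map E cylinder (\<lambda>e. (e, 0))"
      by (simp add: continuous_map_pairwise o_def)
    then have "continuous_map E total (\<lambda>e. point e 0)"
      using continuous_map_compose[OF _ quotient_imp_continuous_map[OF quotient_map_point], of E "\<lambda>e. (e, 0)"]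
      by (simp add: o_def)
    then have "continuous_map E total (\<lambda>e. A (point e 0))"
      by (rule continuous_map_compose[OF _ AC, unfolded o_def])
    then have "openin E {e \<in> topspace E. A (point e 0) \<in> {point d' (b d) | d'. d' \<in> u}}"
      using openin_leaf[OF uE(1)] by (rule openin_continuous_map_preimage)
    moreover have "openin E {e \<in> topspace E. F e \<in> u}"
      using F uE(1) by (rule openin_continuous_map_preimage)
    ultimately have "openin E ({e \<in> topspace E. A (point e 0) \<in> {point d' (b d) | d'. d' \<in> u}}
        \<inter> {e \<in> topspace E. F e \<in> u})" (is "openin E ?U")
      by (rule openin_Int)
    moreover have "d \<in> ?U"
      using d b u by auto
    moreover have "\<forall>e\<in>?U. b e = b d"
    proof
      fix e assume "e \<in> ?U"
      then obtain d' where e: "e \<in> topspace E" "F e \<in> u" "d' \<in> u" "point (F e) (b e) = point d' (b d)"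
        using b by auto
      then have "p (F e) = p d'" "b e - h (F e) = b d - h d'"
        using point_eq_iff uE(2) by (metis subsetD)+
      moreover from this(1) have "F e = d'"
        using sheet_inj[OF sh] e by blast
      ultimately show "b e = b d"
        by simp
    qed
    ultimately show "\<exists>U. openin E U \<and> d \<in> U \<and> (\<forall>w\<in>U. b w = b d)"
      by blast
  qed
  then have A_pt: "A (point e z) = point (F e) (z + b e\<^sub>0)" if "e \<in> topspace E" for e z
    using b[OF that] equiv[OF point_mem[OF that, of 0], of z] that
    by (simp add: circle_action_point add.commute)
  have compat: "fibre_compatible F"
    unfolding fibre_compatible_def
  proof (intro ballI impI)
    fix e e' assume e: "e \<in> topspace E" "e' \<in> topspace E" "p e = p e'"
    then have "point e (h e) = point e' (h e')"
      by (simp add: point_eq_iff)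
    then have "point (F e) (h e + b e\<^sub>0) = point (F e') (h e' + b e\<^sub>0)"
      using A_pt e by metis
    then have "h e + b e\<^sub>0 - h (F e) = h e' + b e\<^sub>0 - h (F e')"
      using FE e by (simp add: point_eq_iff)
    then show "h (F e) - h e = h (F e') - h e'"
      by (simp add: algebra_simps)
  qed
  have "A = bundle_map F (b e\<^sub>0)"
  proof (rule extensionalityI[OF Aext])
    show "bundle_map F (b e\<^sub>0) \<in> extensional (topspace total)"
      by (simp add: bundle_map_def)
    fix u assume "u \<in> topspace total"
    then obtain e z where "e \<in> topspace E" "u = point e z"
      by (rule total_cases)
    then show "A u = bundle_map F (b e\<^sub>0) u"
      using A_pt bundle_map_point[OF compat F pF] by simp
  qed
  with compat that show ?thesis by blast
qed

text \<open>Loops in \<open>X\<close> are the images of paths in \<open>E\<close> between points of one fibre. On such a path the cocycle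
  changes by a difference of \<open>h\<close>, and after \<open>f\<close> by the same difference for the \<open>F\<close>-images of the ends.\<close>

proposition fibre_compatible_iff:
  assumes f: "continuous_map X X f" and F: "continuous_map E E F"
    and pF: "\<And>e. e \<in> topspace E \<Longrightarrow> p (F e) = f (p e)"
  shows "fibre_compatible F \<longleftrightarrow> cohomology_pullback 1 X f \<rho> = \<rho>"
proof -
  have val: "path_value \<phi> (\<lambda>t. f (p (a t))) = h (F (a 1)) - h (F (a 0))" if "pathin E a" for a
  proof -
    have "path_value \<phi> (\<lambda>t. f (p (a t))) = path_value \<phi> (\<lambda>t. p (F (a t)))"
      using pF pathin_image[OF that] by (intro path_value_cong) simp
    then show ?thesis
      using primitive[OF pathin_o[OF that F]] by simp
  qed
  have "fibre_compatible F \<longleftrightarrow>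
    (\<forall>g. pathin X g \<longrightarrow> g 0 = g 1 \<longrightarrow> path_value \<phi> (\<lambda>t. f (g t)) = path_value \<phi> g)"
  proof (intro iffI allI impI)
    fix g assume compat: "fibre_compatible F" and g: "pathin X g" "g 0 = g 1"
    obtain e where e: "e \<in> topspace E" "p e = g 0"
      using pathin_image[OF g(1), of 0] universal_covering_surj[OF uc] by force
    then obtain a where a: "pathin E a" "\<And>t. t \<in> {0..1} \<Longrightarrow> p (a t) = g t"
      using covering_map_path_lift[OF cov g(1)] by metis
    have "path_value \<phi> (\<lambda>t. f (g t)) = path_value \<phi> (\<lambda>t. f (p (a t)))"
      "path_value \<phi> g = path_value \<phi> (\<lambda>t. p (a t))"
      using a(2) by (auto intro: path_value_cong)
    moreover have "h (F (a 0)) - h (a 0) = h (F (a 1)) - h (a 1)"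
      using pathin_image[OF a(1)] a(2) g(2) by (intro fibre_compatibleD[OF compat]) auto
    moreover from this have "h (F (a 1)) - h (F (a 0)) = h (a 1) - h (a 0)"
      by (simp add: algebra_simps)
    ultimately show "path_value \<phi> (\<lambda>t. f (g t)) = path_value \<phi> g"
      using val[OF a(1)] primitive[OF a(1)] by simp
  next
    assume loops: "\<forall>g. pathin X g \<longrightarrow> g 0 = g 1 \<longrightarrow> path_value \<phi> (\<lambda>t. f (g t)) = path_value \<phi> g"
    show "fibre_compatible F"
      unfolding fibre_compatible_def
    proof (intro ballI impI)
      fix e e' assume e: "e \<in> topspace E" "e' \<in> topspace E" "p e = p e'"
      obtain a where a: "pathin E a" "a 0 = e" "a 1 = e'"
        using connect[OF e(1,2)] .
      have "path_value \<phi> (\<lambda>t. f (p (a t))) = path_value \<phi> (\<lambda>t. p (a t))"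
        using loops pathin_o[OF a(1) universal_covering_continuous[OF uc]] a e by simp
      then show "h (F e) - h e = h (F e') - h e'"
        using val[OF a(1)] primitive[OF a(1)] a by (simp add: algebra_simps)
    qed
  qed
  then show ?thesis
    using cohomology_pullback_fixes_iff[OF f cocycle universal_covering_base_path_connected[OF uc]]
    by (simp add: \<rho>_def)
qed


section \<open>The group extension\<close>


lemma homeomorphism_lift:
  assumes "f \<in> carrier (homeo_group X)"
  obtains F F' where "homeomorphic_maps E E F F'" "\<And>e. e \<in> topspace E \<Longrightarrow> p (F e) = f (p e)"
proof -
  obtain f' where f': "homeomorphic_maps X X f f'"
    using assms by (rule homeo_group_maps)
  obtain e where e: "e \<in> topspace E" "p e = f (p e\<^sub>0)"
    using homeo_group_mem[OF assms proj_mem[OF e0]] universal_covering_surj[OF uc] by (metis imageE)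
  show ?thesis
    by (rule universal_covering_lift_homeomorphism[OF uc f' e0 e]) (rule that)
qed

lemma circle_action_mem: "u \<in> topspace total \<Longrightarrow> circle_action u s \<in> topspace total"
  by (auto elim!: total_cases simp: circle_action_point point_mem)

lemma bundle_proj_mem: "u \<in> topspace total \<Longrightarrow> bundle_proj p u \<in> topspace X"
  by (auto elim!: total_cases simp: bundle_proj_point proj_mem)

lemma covers_compose:
  assumes "A \<in> carrier (homeo_group total)" "B \<in> carrier (homeo_group total)" "covers A f" "covers B g"
  shows "covers (A \<otimes>\<^bsub>homeo_group total\<^esub> B) (f \<otimes>\<^bsub>homeo_group X\<^esub> g)"
proof -
  have fg: "f \<in> carrier (homeo_group X)" "g \<in> carrier (homeo_group X)"
    using assms by (auto simp: covers_def)
  have "f \<otimes>\<^bsub>homeo_group X\<^esub> g \<in> carrier (homeo_group X)"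
    using monoid.m_closed[OF group.is_monoid[OF group_homeo_group] fg] .
  then show ?thesis
    using assms homeo_group_mem[OF assms(2)] bundle_proj_mem
    by (simp add: covers_def homeo_group_mult compose_def)
qed

definition translation :: "circle \<Rightarrow> ('e \<times> circle) set \<Rightarrow> ('e \<times> circle) set"
  where "translation = bundle_map (\<lambda>e. e)"

lemma translation_Aut: "translation s \<in> carrier Aut" "covers (translation s) \<one>\<^bsub>homeo_group X\<^esub>"
proof -
  have "\<one>\<^bsub>homeo_group X\<^esub> \<in> carrier (homeo_group X)"
    using group.is_monoid[OF group_homeo_group] by (rule monoid.one_closed)
  moreover have "homeomorphic_maps E E (\<lambda>e. e) (\<lambda>e. e)" "fibre_compatible (\<lambda>e. e)"
    by (auto simp: homeomorphic_maps_def fibre_compatible_def)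
  ultimately show "translation s \<in> carrier Aut" "covers (translation s) \<one>\<^bsub>homeo_group X\<^esub>"
    unfolding translation_def by (auto intro!: bundle_map_Aut simp: homeo_group_one proj_mem)
qed

lemma translation_point: "e \<in> topspace E \<Longrightarrow> translation s (point e z) = point e (z + s)"
  unfolding translation_def
  by (rule bundle_map_point[where f = "\<lambda>x. x"]) (auto simp: fibre_compatible_def)

lemma Aut_subgroup: "subgroup (carrier Aut) (homeo_group total)"
proof (rule group.subgroupI[OF group_homeo_group])
  let ?H = "homeo_group total"
  show "carrier Aut \<subseteq> carrier ?H"
    by (auto simp: Aut_iff)
  show "carrier Aut \<noteq> {}"
    using translation_Aut by blast
  fix A assume A: "A \<in> carrier Aut"
  then obtain f where f: "covers A f"
    by (auto simp: Aut_iff)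
  have AH: "A \<in> carrier ?H"
    using A by (simp add: Aut_iff)
  have iH: "inv\<^bsub>?H\<^esub> A \<in> carrier ?H"
    using group.inv_closed[OF group_homeo_group AH] .
  note cancel = homeo_group_inv_apply[OF AH]
  have fX: "f \<in> carrier (homeo_group X)"
    using f by (simp add: covers_def)
  let ?g = "inv\<^bsub>homeo_group X\<^esub> f"
  have gX: "?g \<in> carrier (homeo_group X)"
    using group.inv_closed[OF group_homeo_group fX] .
  note gf = homeo_group_inv_apply(2)[OF fX]
  have "covers (inv\<^bsub>?H\<^esub> A) ?g"
    unfolding covers_def
  proof (intro conjI ballI gX)
    fix u assume u: "u \<in> topspace total"
    let ?v = "(inv\<^bsub>?H\<^esub> A) u"
    have v: "?v \<in> topspace total"
      using homeo_group_mem[OF iH u] .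
    then have "bundle_proj p u = f (bundle_proj p ?v)" "bundle_proj p ?v \<in> topspace X"
      using f cancel(1)[OF u] bundle_proj_mem[OF v] unfolding covers_def by metis+
    then show "bundle_proj p ?v = ?g (bundle_proj p u)"
      using gf by simp
  qed
  moreover have "(inv\<^bsub>?H\<^esub> A) (circle_action u s) = circle_action ((inv\<^bsub>?H\<^esub> A) u) s" if u: "u \<in> topspace total" for u s
  proof -
    let ?v = "(inv\<^bsub>?H\<^esub> A) u"
    have v: "?v \<in> topspace total"
      using homeo_group_mem[OF iH u] .
    have "A (circle_action ?v s) = circle_action u s"
      using A v cancel(1)[OF u] by (simp add: Aut_iff)
    then show ?thesis
      using cancel(2)[OF circle_action_mem[OF v]] by metis
  qed
  ultimately show "inv\<^bsub>?H\<^esub> A \<in> carrier Aut"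
    using iH by (auto simp: Aut_iff)
next
  fix A B assume AB: "A \<in> carrier Aut" "B \<in> carrier Aut"
  then obtain f g where fg: "covers A f" "covers B g"
    by (auto simp: Aut_iff)
  have H: "A \<in> carrier (homeo_group total)" "B \<in> carrier (homeo_group total)"
    using AB by (auto simp: Aut_iff)
  have "A \<otimes>\<^bsub>homeo_group total\<^esub> B \<in> carrier (homeo_group total)"
    using monoid.m_closed[OF group.is_monoid[OF group_homeo_group] H] .
  moreover have "(A \<otimes>\<^bsub>homeo_group total\<^esub> B) (circle_action u s) =
      circle_action ((A \<otimes>\<^bsub>homeo_group total\<^esub> B) u) s" if "u \<in> topspace total" for u s
    using AB circle_action_mem[OF that] homeo_group_mem[OF H(2) that] that
    by (simp add: homeo_group_mult[OF H] compose_def Aut_iff)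
  ultimately show "A \<otimes>\<^bsub>homeo_group total\<^esub> B \<in> carrier Aut"
    using covers_compose[OF H fg] by (auto simp: Aut_iff)
qed

lemma Aut_eq: "Aut = homeo_group total \<lparr>carrier := carrier Aut\<rparr>"
  by (simp add: bundle_aut_group_def Let_def)

lemma group_Aut: "group Aut"
  using subgroup.subgroup_is_group[OF Aut_subgroup group_homeo_group] Aut_eq by simp

lemma Aut_mult: "A \<otimes>\<^bsub>Aut\<^esub> B = A \<otimes>\<^bsub>homeo_group total\<^esub> B"
  by (simp add: bundle_aut_group_def Let_def)

abbreviation "\<pi> \<equiv> base_map E X p e\<^sub>0 \<rho>"

lemma covers_base_map: "A \<in> carrier Aut \<Longrightarrow> covers A (\<pi> A)"
  using base_map_eq by (auto simp: Aut_iff)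

proposition base_map_hom: "group_hom Aut (homeo_group X) \<pi>"
proof (intro group_hom.intro group_hom_axioms.intro group_Aut group_homeo_group homI)
  fix A B assume A: "A \<in> carrier Aut" and B: "B \<in> carrier Aut"
  then have H: "A \<in> carrier (homeo_group total)" "B \<in> carrier (homeo_group total)"
    by (auto simp: Aut_iff)
  show "\<pi> A \<in> carrier (homeo_group X)"
    using covers_base_map[OF A] by (simp add: covers_def)
  show "\<pi> (A \<otimes>\<^bsub>Aut\<^esub> B) = \<pi> A \<otimes>\<^bsub>homeo_group X\<^esub> \<pi> B"
    unfolding Aut_mult using covers_compose[OF H covers_base_map[OF A] covers_base_map[OF B]]
    by (rule base_map_eq)
qed

proposition base_map_image: "\<pi> ` carrier Aut = carrier (homeo_group_preserving 1 X \<rho>)"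
proof (intro subset_antisym subsetI)
  fix f assume "f \<in> \<pi> ` carrier Aut"
  then obtain A where A: "A \<in> carrier Aut" "covers A f"
    using covers_base_map by blast
  then have f: "f \<in> carrier (homeo_group X)"
    by (simp add: covers_def)
  obtain F F' where F: "homeomorphic_maps E E F F'" "\<And>e. e \<in> topspace E \<Longrightarrow> p (F e) = f (p e)"
    using homeomorphism_lift[OF f] by blast
  then have cF: "continuous_map E E F"
    by (simp add: homeomorphic_maps_def)
  have "fibre_compatible F"
    using Aut_eq_bundle_map[OF A cF F(2)] by blast
  then show "f \<in> carrier (homeo_group_preserving 1 X \<rho>)"
    using f fibre_compatible_iff[OF homeo_group_continuous[OF f] cF F(2)]
    by (simp add: homeo_group_preserving_def)
next
  fix f assume "f \<in> carrier (homeo_group_preserving 1 X \<rho>)"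
  then have f: "f \<in> carrier (homeo_group X)" and pres: "cohomology_pullback 1 X f \<rho> = \<rho>"
    by (auto simp: homeo_group_preserving_def)
  obtain F F' where F: "homeomorphic_maps E E F F'" "\<And>e. e \<in> topspace E \<Longrightarrow> p (F e) = f (p e)"
    using homeomorphism_lift[OF f] by blast
  then have cF: "continuous_map E E F"
    by (simp add: homeomorphic_maps_def)
  have compat: "fibre_compatible F"
    using fibre_compatible_iff[OF homeo_group_continuous[OF f] cF F(2)] pres by simp
  have "bundle_map F 0 \<in> carrier Aut" "covers (bundle_map F 0) f"
    using bundle_map_Aut[OF f F(1) compat F(2)] by auto
  then show "f \<in> \<pi> ` carrier Aut"
    using base_map_eq by (metis imageI)
qed

text \<open>The identity of \<open>E\<close> is a lift of the identity of \<open>X\<close>.\<close>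

proposition base_map_kernel: "kernel Aut (homeo_group X) \<pi> = range translation"
proof (intro subset_antisym subsetI)
  fix A assume "A \<in> kernel Aut (homeo_group X) \<pi>"
  then have A: "A \<in> carrier Aut" "covers A \<one>\<^bsub>homeo_group X\<^esub>"
    using covers_base_map[of A] by (auto simp: kernel_def)
  obtain s where "A = bundle_map (\<lambda>e. e) s"
    by (rule Aut_eq_bundle_map[OF A, of "\<lambda>e. e"]) (auto simp: homeo_group_one proj_mem)
  then show "A \<in> range translation"
    by (simp add: translation_def)
next
  fix A assume "A \<in> range translation"
  then show "A \<in> kernel Aut (homeo_group X) \<pi>"
    using translation_Aut base_map_eq by (auto simp: kernel_def)
qed

lemma group_circle_group: "group circle_group"
  by (rule groupI) (auto simp: circle_group_def add.assoc intro: exI[of _ "- x" for x] left_minus)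

lemma translation_hom: "group_hom circle_group Aut translation"
proof (intro group_hom.intro group_hom_axioms.intro group_circle_group group_Aut homI)
  fix s t :: circle
  show "translation s \<in> carrier Aut"
    by (rule translation_Aut)
  have H: "translation r \<in> carrier (homeo_group total)" for r
    using translation_Aut(1) by (simp add: Aut_iff)
  have "translation (s + t) = compose (topspace total) (translation s) (translation t)"
  proof (rule extensionalityI[of _ "topspace total"])
    show "translation (s + t) \<in> extensional (topspace total)"
      by (simp add: translation_def bundle_map_def)
    fix u assume "u \<in> topspace total"
    then obtain e z where "e \<in> topspace E" "u = point e z"
      by (rule total_cases)
    then show "translation (s + t) u = compose (topspace total) (translation s) (translation t) u"
      by (simp add: compose_eq point_mem translation_point add_ac)
  qed simp
  then show "translation (s \<otimes>\<^bsub>circle_group\<^esub> t) = translation s \<otimes>\<^bsub>Aut\<^esub> translation t"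
    by (simp add: circle_group_def Aut_mult homeo_group_mult[OF H H])
qed

text \<open>The circle acts freely on the total space.\<close>

lemma inj_translation: "inj translation"
proof (rule injI)
  fix s t assume "translation s = translation t"
  then have "point e\<^sub>0 (0 + s) = point e\<^sub>0 (0 + t)"
    using translation_point[OF e0] by metis
  then show "s = t"
    using e0 by (simp add: point_eq_iff)
qed

lemma kernel_iso_circle:
  "Aut \<lparr>carrier := kernel Aut (homeo_group X) \<pi>\<rparr> \<cong> circle_group"
proof -
  have "translation \<in> iso circle_group (Aut \<lparr>carrier := kernel Aut (homeo_group X) \<pi>\<rparr>)"
  proof (rule isoI)
    show "translation \<in> hom circle_group (Aut \<lparr>carrier := kernel Aut (homeo_group X) \<pi>\<rparr>)"
      using group_hom.homh[OF translation_hom] base_map_kernel by (auto simp: hom_def)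
    show "bij_betw translation (carrier circle_group)
        (carrier (Aut \<lparr>carrier := kernel Aut (homeo_group X) \<pi>\<rparr>))"
      using inj_translation base_map_kernel by (simp add: bij_betw_def circle_group_def)
  qed
  then have "circle_group \<cong> Aut \<lparr>carrier := kernel Aut (homeo_group X) \<pi>\<rparr>"
    by (auto simp: is_iso_def)
  then show ?thesis
    by (rule group.iso_sym[OF group_circle_group])
qed

proposition translation_base_map_exact:
  "short_exact circle_group Aut (homeo_group_preserving 1 X \<rho>) translation \<pi>"
proof -
  let ?G = "homeo_group_preserving 1 X \<rho>"
  have G: "?G = homeo_group X \<lparr>carrier := carrier ?G\<rparr>"
    by (simp add: homeo_group_preserving_def)
  have "subgroup (carrier ?G) (homeo_group X)"
    using group_hom.img_is_subgroup[OF base_map_hom] base_map_image by simp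
  then have "group ?G"
    using subgroup.subgroup_is_group[OF _ group_homeo_group] G by metis
  moreover have "\<pi> \<in> hom Aut ?G"
    using group_hom.homh[OF base_map_hom] base_map_image
    by (auto simp: hom_def homeo_group_preserving_def)
  moreover have "kernel Aut ?G \<pi> = range translation"
    using base_map_kernel by (simp add: kernel_def homeo_group_preserving_def)
  ultimately show ?thesis
    unfolding short_exact_def
    using translation_hom group_Aut inj_translation base_map_image
    by (auto simp: group_hom_def group_hom_axioms_def circle_group_def)
qed

end

theorem lemma4p1:
  fixes X :: "'a topology" and E :: "'e topology" and p :: "'e \<Rightarrow> 'a" and e\<^sub>0 :: 'e
    and c :: "('a chain \<Rightarrow> int) set" and \<rho> :: "('a chain \<Rightarrow> circle) set"
  defines "G \<equiv> homeo_group_preserving 2 X c"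
    and "Aut \<equiv> bundle_aut_group E X p e\<^sub>0 \<rho>"
    and "\<pi> \<equiv> base_map E X p e\<^sub>0 \<rho>"
  assumes "connected_space X"
    and "universal_covering E X p" and "e\<^sub>0 \<in> topspace E"
    and "trivial_group (cohomology_group 1 X :: ('a chain \<Rightarrow> int) set monoid)"
    and "c \<in> carrier (cohomology_group 2 X)"
    and "c \<noteq> \<one>\<^bsub>cohomology_group 2 X\<^esub>"
    and "coefficient_map 2 X real_of_int c = \<one>\<^bsub>cohomology_group 2 X\<^esub>"
    and "\<rho> \<in> carrier (cohomology_group 1 X)"
    and "connecting_hom 1 X \<rho> = c"
    and "homeo_group_preserving 1 X \<rho> = G"
  shows "group_hom Aut (homeo_group X) \<pi> \<and>
         \<pi> ` carrier Aut = carrier G \<and>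
         Aut \<lparr>carrier := kernel Aut (homeo_group X) \<pi>\<rparr> \<cong> circle_group \<and>
         (\<exists>\<iota>. short_exact circle_group Aut G \<iota> \<pi>)"
proof -
  obtain \<phi> where \<phi>: "\<phi> \<in> cocycles 1 X" "\<rho> = cohomology_class 1 X \<phi>"
    using \<open>\<rho> \<in> carrier (cohomology_group 1 X)\<close> by (rule cohomology_group_cases)
  obtain h where h: "\<And>g. pathin E g \<Longrightarrow> path_value \<phi> (\<lambda>t. p (g t)) = h (g 1) - h (g 0)"
    using path_value_lift_primitive[OF \<open>universal_covering E X p\<close> \<phi>(1)] by blast
  interpret B: flat_circle_bundle X E p e\<^sub>0 \<phi> h
    by unfold_locales (use assms \<phi> h in auto)
  have "B.\<rho> = \<rho>"
    using \<phi>(2) by (simp add: B.\<rho>_def)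
  then show ?thesis
    using B.base_map_hom B.base_map_image B.kernel_iso_circle B.translation_base_map_exact
      \<open>homeo_group_preserving 1 X \<rho> = G\<close>
    unfolding Aut_def \<pi>_def by metis
qed

end
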